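(* Consider the following assumptions: (i) $I(g_0)<\infty$; (ii) $0<\eta_0\le g_0\le\eta_1$ for some constants $\eta_0,\eta_1$; (iii) there is a constant $c<\infty$ such that $\sup_{g\in\mathcal{G}_M}\|g\|_\infty\le cM$ for each $M\ge1$; (iv) for some $0<\gamma<2$, $\mathcal{H}^B_\delta(\mathcal{G}_M,L_2(\mathbb{Q}))=O\big((M/\delta)^\gamma\big)$ for any $\delta>0$. (a) Suppose that assumptions (i)–(iv) hold, and that the regularization parameter $\lambda_n\to0$ is chosen such that $\lambda_n^{-1}=O_{\mathbb{P}}\big(n^{2/(2+\gamma)}\big)$. Then, under $\mathbb{P}$, $h_{\mathbb{Q}}(g_0,\widehat g_n)=O_{\mathbb{P}}(\lambda_n^{1/2})$. (b) Suppose that, in addition to assumptions (i)–(iv), there holds $\inf_{x\in\mathcal{X}}\inf_{g\in\mathcal{G}}g(x)\ge\eta_0$. Then $|\widehat D_K-D_K(\mathbb{P},\mathbb{Q})|=O_{\mathbb{P}}(n^{-1/2})$.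
   Context: Setting: $\mathbb{P},\mathbb{Q}$ are probability distributions on a compact domain $\mathcal{X}\subset\mathbb{R}^d$, absolutely continuous with respect to Lebesgue measure $\mu$ with densities $p_0,q_0$; $\mathbb{P}$ is absolutely continuous with respect to $\mathbb{Q}$. Put $g_0:=p_0/q_0$ (the likelihood ratio) and $D_K(\mathbb{P},\mathbb{Q}):=\int p_0\log(p_0/q_0)\,d\mu$ (the Kullback-Leibler divergence). Samples: $X^{(1)},\dots,X^{(n)}$ are drawn i.i.d. from $\mathbb{P}$ and $Y^{(1)},\dots,Y^{(n)}$ are drawn i.i.d. from $\mathbb{Q}$; $\mathbb{P}_n,\mathbb{Q}_n$ are the corresponding empirical distributions. Estimator: $I$ is a non-negative functional measuring the complexity of functions $g:\mathcal{X}\to\mathbb{R}_+$; $\mathcal{G}_M:=\{g: I(g)\le M\}$ and $\mathcal{G}:=\bigcup_{1\le M\le\infty}\mathcal{G}_M$. With $\lambda_n>0$ a regularization parameter, $$\widehat g_n=\arg\min_{g\in\mathcal{G}}\Big\{\int g\,d\mathbb{Q}_n-\int\log g\,d\mathbb{P}_n+\frac{\lambda_n}{2}I^2(g)\Big\},\qquad \widehat D_K=\int\log\widehat g_n\,d\mathbb{P}_n-\int\widehat g_n\,d\mathbb{Q}_n+1.$$ (Generalized) Hellinger distance: $h_{\mathbb{Q}}^2(g_0,g):=\frac12\int(\sqrt{g_0}-\sqrt g)^2\,d\mathbb{Q}$. Bracketing entropy: $N^B_\delta(\mathcal{F},L_2(\mathbb{Q}))$ is the smallest $N$ for which there exist $N$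 pairs of functions $\{f_j^L,f_j^U\}$ with $\|f_j^U-f_j^L\|_{L_2(\mathbb{Q})}\le\delta$ such that for each $f\in\mathcal{F}$ there is a $j$ with $f_j^L\le f\le f_j^U$; $\mathcal{H}^B_\delta(\mathcal{F},L_2(\mathbb{Q})):=\log N^B_\delta(\mathcal{F},L_2(\mathbb{Q}))$. $Z_n=O_{\mathbb{P}}(a_n)$ means that $Z_n/a_n$ is bounded in probability with respect to $\mathbb{P}$.
   Formalization: In (b), the conditions on λ_n from (a) are kept and λ_n = O_P(n^{-1/2}) is additionally assumed; without an upper rate on λ_n the claim is false (e.g. λ_n = 1/log n gives a bias of order λ_n^2), and λ_n ≍ n^{-2/(2+γ)} is covered. *)

theory Defs
  imports "HOL-Probability.Probability"
begin

text \<open>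
  \<open>Z\<^sub>n = O\<^sub>P(a\<^sub>n)\<close> for \<open>a\<^sub>n > 0\<close>, possibly random. The events are covered by measurable sets,
  i.e. their outer probability is bounded: the minimiser in the estimator below need not
  depend measurably on the sample, and \<^const>\<open>measure\<close> is 0 on non-measurable sets.
\<close>

definition bigO_prob :: "'w measure \<Rightarrow> (nat \<Rightarrow> 'w \<Rightarrow> real) \<Rightarrow> (nat \<Rightarrow> 'w \<Rightarrow> real) \<Rightarrow> bool" where
  "bigO_prob M Z a \<longleftrightarrow>
     (\<forall>\<epsilon>>0. \<exists>C>0. \<forall>\<^sub>F n in sequentially.
        \<exists>A\<in>sets M. {\<omega> \<in> space M. \<bar>Z n \<omega>\<bar> > C * a n \<omega>} \<subseteq> A \<and> measure M A \<le> \<epsilon>)"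

definition iid_sample :: "'w measure \<Rightarrow> 'a measure \<Rightarrow> (nat \<Rightarrow> 'w \<Rightarrow> 'a) \<Rightarrow> bool" where
  "iid_sample M P X \<longleftrightarrow> prob_space.indep_vars M (\<lambda>_. P) X UNIV \<and> (\<forall>i. distr M P (X i) = P)"

definition hellinger_dist :: "'a measure \<Rightarrow> ('a \<Rightarrow> real) \<Rightarrow> ('a \<Rightarrow> real) \<Rightarrow> real" where
  "hellinger_dist Q f g = sqrt (1/2 * (LINT x|Q. (sqrt (f x) - sqrt (g x))\<^sup>2))"

definition bracketing_number :: "'a measure \<Rightarrow> real \<Rightarrow> ('a \<Rightarrow> real) set \<Rightarrow> enat" where
  "bracketing_number Q \<delta> F = Inf {enat N | N. \<exists>fL fU :: nat \<Rightarrow> 'a \<Rightarrow> real.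
     (\<forall>j<N. fL j \<in> borel_measurable Q \<and> fU j \<in> borel_measurable Q \<and>
        integrable Q (\<lambda>x. (fU j x - fL j x)\<^sup>2) \<and>
        sqrt (LINT x|Q. (fU j x - fL j x)\<^sup>2) \<le> \<delta>) \<and>
     (\<forall>f\<in>F. \<exists>j<N. \<forall>x\<in>space Q. fL j x \<le> f x \<and> f x \<le> fU j x)}"

text \<open>For the empty class the number is 0 and, since \<open>ln 0 = 0\<close> here, the entropy is 0 as well.\<close>

definition bracketing_entropy :: "'a measure \<Rightarrow> real \<Rightarrow> ('a \<Rightarrow> real) set \<Rightarrow> ereal" where
  "bracketing_entropy Q \<delta> F =
     (case bracketing_number Q \<delta> F of enat N \<Rightarrow> ereal (ln (real N)) | \<infinity> \<Rightarrow> \<infinity>)"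

text \<open>
  The complexity functional \<open>J\<close> takes values in \<open>[0,\<infinity>]\<close>; \<open>D\<close> is the set of functions on
  which it is defined. As \<open>M = \<infinity>\<close> is allowed, \<^term>\<open>complexity_class D J\<close> is all of \<open>D\<close>.
\<close>

definition complexity_ball ::
    "('a \<Rightarrow> real) set \<Rightarrow> (('a \<Rightarrow> real) \<Rightarrow> ereal) \<Rightarrow> ereal \<Rightarrow> ('a \<Rightarrow> real) set" where
  "complexity_ball D J M = {g \<in> D. J g \<le> M}"

definition complexity_class ::
    "('a \<Rightarrow> real) set \<Rightarrow> (('a \<Rightarrow> real) \<Rightarrow> ereal) \<Rightarrow> ('a \<Rightarrow> real) set" where
  "complexity_class D J = (\<Union>M\<in>{1..\<infinity>}. complexity_ball D J M)"

text \<open>The objective needs \<open>log 0 = -\<infinity>\<close>, whereas \<^term>\<open>ln (0::real)\<close> is 0.\<close>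

definition ext_ln :: "real \<Rightarrow> ereal" where
  "ext_ln t = (if t \<le> 0 then -\<infinity> else ereal (ln t))"

text \<open>\<open>x i\<close> and \<open>y i\<close> for \<open>i < n\<close> are the sample points; integrals with respect to the
  empirical distributions are averages over them.\<close>

definition penalized_risk ::
    "(('a \<Rightarrow> real) \<Rightarrow> ereal) \<Rightarrow> real \<Rightarrow> nat \<Rightarrow> (nat \<Rightarrow> 'a) \<Rightarrow> (nat \<Rightarrow> 'a) \<Rightarrow> ('a \<Rightarrow> real) \<Rightarrow> ereal" where
  "penalized_risk J lam n x y g =
     ereal ((\<Sum>i<n. g (y i)) / real n) - (\<Sum>i<n. ext_ln (g (x i))) / ereal (real n)
       + ereal (lam / 2) * (J g)\<^sup>2"

text \<open>Used only at minimisers of the risk, which are positive at every \<open>x i\<close> as soon as some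
  function in the class has finite risk.\<close>

definition kl_estimate :: "nat \<Rightarrow> (nat \<Rightarrow> 'a) \<Rightarrow> (nat \<Rightarrow> 'a) \<Rightarrow> ('a \<Rightarrow> real) \<Rightarrow> real" where
  "kl_estimate n x y g = (\<Sum>i<n. ln (g (x i))) / real n - (\<Sum>i<n. g (y i)) / real n + 1"

text \<open>The library's divergence takes the base of the logarithm and the reference measure first.\<close>

lemma KL_divergence_densities:
  fixes X :: "'a::euclidean_space set"
  defines "\<mu> \<equiv> restrict_space lborel X"
  assumes "compact X"
    and p: "p \<in> borel_measurable \<mu>" "\<And>x. x \<in> X \<Longrightarrow> 0 \<le> p x"
    and q: "q \<in> borel_measurable \<mu>" "\<And>x. x \<in> X \<Longrightarrow> 0 \<le> q x"
    and ac: "absolutely_continuous (density \<mu> (\<lambda>x. ennreal (q x))) (density \<mu> (\<lambda>x. ennreal (p x)))"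
  shows "KL_divergence (exp 1) (density \<mu> (\<lambda>x. ennreal (q x))) (density \<mu> (\<lambda>x. ennreal (p x)))
           = (LINT x|\<mu>. p x * ln (p x / q x))"
proof -
  have X: "X \<in> sets lborel" using \<open>compact X\<close> by (simp add: borel_compact)
  have sp: "space \<mu> = X" unfolding \<mu>_def by (simp add: space_restrict_space)
  interpret sigma_finite_measure \<mu>
    unfolding \<mu>_def using X by (intro sigma_finite_measure_restrict_space lborel.sigma_finite_measure_axioms) auto
  let ?A = "{x \<in> space \<mu>. q x = 0}"
  have A: "?A \<in> sets \<mu>" using q(1) by measurable
  have "?A \<in> null_sets (density \<mu> (\<lambda>x. ennreal (q x)))"
    using q(1) A by (subst null_sets_density_iff) auto
  then have "?A \<in> null_sets (density \<mu> (\<lambda>x. ennreal (p x)))"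
    using ac by (auto simp: absolutely_continuous_def)
  then have "AE x in \<mu>. x \<in> ?A \<longrightarrow> ennreal (p x) = 0"
    using p(1) by (subst (asm) null_sets_density_iff) auto
  then have ae: "AE x in \<mu>. q x = 0 \<longrightarrow> p x = 0"
    using AE_space by eventually_elim (use p(2) sp in \<open>auto simp: ennreal_eq_0_iff intro: antisym\<close>)
  have "KL_divergence (exp 1) (density \<mu> (\<lambda>x. ennreal (q x))) (density \<mu> (\<lambda>x. ennreal (p x)))
     = (LINT x|\<mu>. p x * log (exp 1) (p x / q x))"
    by (rule KL_density_density) (use p q ae sp in \<open>auto intro!: AE_I2\<close>)
  then show ?thesis by (simp add: log_def)
qed

end

theory Submission
  imports Defs "HOL-Real_Asymp.Real_Asymp"
begin

text \<open>
  Let \<open>m = (ghat + g\<^sub>0) / 2\<close>. Comparing the penalised risks of \<open>ghat\<close> and \<open>g\<^sub>0\<close> and using concavity of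
  the logarithm bounds \<open>\<integral>(sqrt m - sqrt g\<^sub>0)\<^sup>2 dQ\<close> plus the excess penalty by the upper deviations of the
  empirical means of \<open>ln (m / g\<^sub>0)\<close> under \<open>P\<close> and of \<open>g\<^sub>0 - m\<close> under \<open>Q\<close>. With
  \<open>\<delta>\<^sub>n = n powr (-1 / (2 + \<gamma>))\<close>, these deviations are, uniformly over the dyadic balls
  \<open>J g \<le> 2\<^sup>j\<close>, at most a small multiple of the integral plus \<open>O((1 + j) 2\<^sup>j \<delta>\<^sub>n\<^sup>2)\<close>: each bracket at
  scale \<open>2\<^sup>j \<delta>\<^sub>n\<close> obeys a Bernstein bound in which its own second moment appears, and the
  refinements are controlled by one-sided chaining. As \<open>\<delta>\<^sub>n\<^sup>2 = O(\<lambda>\<^sub>n)\<close> and \<open>(1 + j) 2\<^sup>j = o(4\<^sup>j)\<close>,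
  the penalty \<open>\<lambda>\<^sub>n J(ghat)\<^sup>2\<close> absorbs the remainder, which gives (a).

  The same inequality bounds the divergence estimate from above up to \<open>O(\<delta>\<^sub>n\<^sup>2)\<close>, which is
  \<open>O(n powr (-1 / 2))\<close>; minimality of \<open>ghat\<close> bounds it from below up to \<open>\<lambda>\<^sub>n J(g\<^sub>0)\<^sup>2 / 2\<close>. What is
  left are the fluctuations of the means of \<open>ln g\<^sub>0\<close> and \<open>g\<^sub>0\<close>.
\<close>

section \<open>Deviations of empirical means\<close>

text \<open>Two obstacles shape the proof: the estimator may come arbitrarily close to 0, and its
  complexity is random, so \<open>ln (ghat / g0)\<close> has no bound fixed in advance. The midpoint
  settles the first: \<open>m \<ge> g0 / 2\<close>, so \<open>ln (m / g0)\<close> is at least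
  \<open>- ln 2\<close> and Lipschitz in the estimator. Scaling settles the second. Functions in the
  ball of radius \<open>2 ^ j\<close> have size of order \<open>2 ^ j\<close>, so the exponential
  bound is used with a parameter of order \<open>1 / 2 ^ j\<close>. The second moment is at most a
  constant times \<open>2 ^ j\<close> times the Hellinger term. The two factors cancel, and the
  fraction of the Hellinger term that is lost is the same in every ball.

  The rate solves \<open>n * \<delta>^2 = \<delta> powr (- \<gamma>)\<close>: at this relative scale
  the entropy of a ball has the order of the exponent in the tail bound. Finer scales then
  contribute, up to a linear factor, a geometric series with ratio
  \<open>2 powr (\<gamma> / 2) / 2\<close>, which is below 1 because \<gamma> < 2.\<close>

definition deviation :: "'a measure \<Rightarrow> nat \<Rightarrow> (nat \<Rightarrow> 'a) \<Rightarrow> ('a \<Rightarrow> real) \<Rightarrow> real" where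
  "deviation R n z f = (\<Sum>i<n. f (z i)) / real n - (LINT x|R. f x)"

definition bdd_measurable :: "'a measure \<Rightarrow> real \<Rightarrow> ('a \<Rightarrow> real) set" where
  "bdd_measurable R b = {f \<in> borel_measurable R. \<forall>x\<in>space R. \<bar>f x\<bar> \<le> b}"

lemma bdd_measurableI:
  "f \<in> borel_measurable R \<Longrightarrow> (\<And>x. x \<in> space R \<Longrightarrow> \<bar>f x\<bar> \<le> b) \<Longrightarrow> f \<in> bdd_measurable R b"
  by (simp add: bdd_measurable_def)

lemma bdd_measurableD:
  assumes "f \<in> bdd_measurable R b"
  shows "f \<in> borel_measurable R" "x \<in> space R \<Longrightarrow> \<bar>f x\<bar> \<le> b"
  using assms by (auto simp: bdd_measurable_def)

lemma bdd_measurable_integrable: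
  assumes "prob_space R" "f \<in> bdd_measurable R b"
  shows "integrable R f"
proof -
  interpret prob_space R by fact
  show ?thesis
    by (rule integrable_const_bound[where B = b]) (use assms(2) in \<open>auto simp: bdd_measurable_def\<close>)
qed

lemma bdd_measurable_square:
  assumes "f \<in> bdd_measurable R b"
  shows "(\<lambda>x. (f x)\<^sup>2) \<in> bdd_measurable R (b\<^sup>2)"
  using assms by (fastforce simp: bdd_measurable_def intro: abs_le_square_iff[THEN iffD1, of _ b, simplified] power_mono[of "\<bar>_\<bar>" b 2, simplified])

lemma bdd_measurable_diff:
  assumes "f \<in> bdd_measurable R b" "g \<in> bdd_measurable R c"
  shows "(\<lambda>x. f x - g x) \<in> bdd_measurable R (b + c)"
  using assms by (fastforce simp: bdd_measurable_def)

lemma bdd_measurable_min: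
  assumes "f \<in> bdd_measurable R b" "g \<in> bdd_measurable R b"
  shows "(\<lambda>x. min (f x) (g x)) \<in> bdd_measurable R b"
  using assms by (fastforce simp: bdd_measurable_def)

text \<open>For negative \<open>z\<close>, multiply by \<open>1 - z > 0\<close>:
  \<open>(1 - z) * (1 + z + z^2) = 1 - z^3 \<ge> 1\<close>, while
  \<open>(1 - z) * exp z \<le> 1\<close>. The range reaches down to arbitrarily negative
  \<open>z\<close>, which is what makes one-sided tail bounds possible.\<close>

lemma exp_le_quadratic:
  fixes z :: real
  assumes "z \<le> 1"
  shows "exp z \<le> 1 + z + z\<^sup>2"
proof (cases "0 \<le> z")
  case True
  then show ?thesis using exp_bound[of z] assms by simp
next
  case False
  have "1 - z \<le> exp (- z)" using exp_ge_add_one_self[of "- z"] by simp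
  then have "(1 - z) * exp z \<le> 1"
    using mult_right_mono[of "1 - z" "exp (- z)" "exp z"] by (simp flip: exp_add)
  moreover have "1 \<le> (1 - z) * (1 + z + z\<^sup>2)"
    using False power_mono[of 0 "- z" 3] by (simp add: algebra_simps power2_eq_square power3_eq_cube mult_le_0_iff)
  ultimately have "(1 - z) * exp z \<le> (1 - z) * (1 + z + z\<^sup>2)" by linarith
  then show ?thesis using False by (simp add: mult_le_cancel_left)
qed

lemma iid_sampleD:
  assumes "prob_space M" "iid_sample M R Z"
  shows "Z i \<in> measurable M R" "distr M R (Z i) = R" "prob_space R"
proof -
  interpret prob_space M by fact
  show Z: "Z i \<in> measurable M R" for i
    using assms(2) by (auto simp: iid_sample_def indep_vars_def)
  show d: "distr M R (Z i) = R" for i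
    using assms(2) by (auto simp: iid_sample_def)
  show "prob_space R" using prob_space_distr[OF Z[of 0]] d[of 0] by simp
qed

text \<open>The variance proxy is the second moment and only an upper bound on \<open>s f\<close> is needed, so
  nonpositive \<open>f\<close> have sub-Gaussian upper tails whatever their size.\<close>

lemma chernoff_iid:
  assumes M: "prob_space M" "iid_sample M R Z"
    and f: "f \<in> bdd_measurable R b"
    and s: "0 < s" "\<And>x. x \<in> space R \<Longrightarrow> s * f x \<le> 1" and n: "0 < n"
  shows "measure M {\<omega>\<in>space M. s * (LINT x|R. (f x)\<^sup>2) + t / (n * s) \<le> deviation R n (\<lambda>i. Z i \<omega>) f}
           \<le> exp (- t)"
proof -
  interpret prob_space M by fact
  note Z = iid_sampleD[OF M]
  interpret R: prob_space R by (rule Z(3))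
  note [measurable] = Z(1) and fm [measurable] = bdd_measurableD(1)[OF f]
  define m v where "m = (LINT x|R. f x)" and "v = (LINT x|R. (f x)\<^sup>2)"
  let ?u = "\<lambda>\<omega>. \<Prod>i<n. exp (s * f (Z i \<omega>))"
  have int: "integrable R (\<lambda>x. exp (s * f x))"
    by (rule R.integrable_const_bound[where B = "exp 1"]) (use s(2) in auto)
  have intf: "integrable R f" "integrable R (\<lambda>x. (f x)\<^sup>2)"
    using bdd_measurable_integrable[OF Z(3)] f bdd_measurable_square[OF f] by auto
  have "(LINT x|R. exp (s * f x)) \<le> (LINT x|R. 1 + s * f x + s\<^sup>2 * (f x)\<^sup>2)"
    using exp_le_quadratic[OF s(2)] intf int
    by (intro integral_mono) (auto simp: power_mult_distrib)
  also have "\<dots> = 1 + s * m + s\<^sup>2 * v"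
    using intf by (simp add: m_def v_def R.prob_space)
  also have "\<dots> \<le> exp (s * m + s\<^sup>2 * v)"
    using exp_ge_add_one_self[of "s * m + s\<^sup>2 * v"] by (simp add: add.assoc)
  finally have mgf: "(LINT x|R. exp (s * f x)) \<le> exp (s * m + s\<^sup>2 * v)" .
  have "indep_vars (\<lambda>_. R) Z {..<n}"
    using M(2) by (auto simp: iid_sample_def intro: indep_vars_subset)
  then have ind: "indep_vars (\<lambda>_. borel) (\<lambda>i \<omega>. exp (s * f (Z i \<omega>))) {..<n}"
    by (rule indep_vars_compose2) measurable
  have eq: "(LINT \<omega>|M. exp (s * f (Z i \<omega>))) = (LINT x|R. exp (s * f x))" for i
    using integral_distr[OF Z(1)[of i], of "\<lambda>x. exp (s * f x)"] Z(2)[of i] by simp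
  have inti: "integrable M (\<lambda>\<omega>. exp (s * f (Z i \<omega>)))" for i
    using integrable_distr_eq[OF Z(1)[of i], of "\<lambda>x. exp (s * f x)"] Z(2)[of i] int by simp
  have "(LINT \<omega>|M. ?u \<omega>) = (LINT x|R. exp (s * f x)) ^ n"
    using indep_vars_lebesgue_integral[OF _ ind] inti eq by simp
  also have "\<dots> \<le> exp (s * m + s\<^sup>2 * v) ^ n"
    by (intro power_mono mgf) simp
  also have "\<dots> = exp (n * (s * m + s\<^sup>2 * v))"
    by (simp add: exp_of_nat_mult)
  finally have E: "(LINT \<omega>|M. ?u \<omega>) \<le> exp (n * (s * m + s\<^sup>2 * v))" .
  have intu: "integrable M ?u"
    using indep_vars_integrable[OF _ ind] inti by simp
  \<comment> \<open>Multiplying the threshold by \<open>n * s\<close> turns the event into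
    \<open>?c \<le> ?u \<omega>\<close>. As \<open>?c\<close> exceeds the moment bound
    \<open>E\<close> by exactly the factor \<open>exp t\<close>, Markov's inequality leaves
    \<open>exp (- t)\<close>.\<close>
  let ?c = "exp (n * (s * m + s\<^sup>2 * v) + t)"
  have "s * v + t / (n * s) \<le> deviation R n (\<lambda>i. Z i \<omega>) f \<longleftrightarrow> ?c \<le> ?u \<omega>" for \<omega>
  proof -
    have "s * v + t / (n * s) \<le> deviation R n (\<lambda>i. Z i \<omega>) f \<longleftrightarrow>
        (s * v + t / (n * s) + m) * (n * s) \<le> (\<Sum>i<n. f (Z i \<omega>)) / n * (n * s)"
      using s n by (subst mult_le_cancel_right_pos) (auto simp: deviation_def m_def algebra_simps)
    also have "(s * v + t / (n * s) + m) * (n * s) = n * (s * m + s\<^sup>2 * v) + t"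
      using s n by (simp add: field_simps power2_eq_square)
    also have "(\<Sum>i<n. f (Z i \<omega>)) / n * (n * s) = (\<Sum>i<n. s * f (Z i \<omega>))"
      unfolding sum_distrib_left[symmetric] using n by simp
    finally show ?thesis by (simp add: exp_sum[symmetric])
  qed
  then have "measure M {\<omega>\<in>space M. s * v + t / (n * s) \<le> deviation R n (\<lambda>i. Z i \<omega>) f} =
      measure M {\<omega>\<in>space M. ?c \<le> ?u \<omega>}" by simp
  also have "\<dots> \<le> (LINT \<omega>|M. ?u \<omega>) / ?c"
    by (rule integral_Markov_inequality_measure[OF intu, of "{}"]) (auto simp: prod_nonneg)
  also have "\<dots> \<le> exp (n * (s * m + s\<^sup>2 * v)) / ?c"
    by (intro divide_right_mono E) simp
  also have "\<dots> = exp (- t)" by (simp add: exp_add exp_minus field_simps)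
  finally show ?thesis by (simp add: v_def)
qed

lemma integral_le_sqrt_integral_square:
  assumes "prob_space R" "f \<in> bdd_measurable R b" "(LINT x|R. (f x)\<^sup>2) \<le> d\<^sup>2" "0 \<le> d"
  shows "(LINT x|R. f x) \<le> d"
proof -
  interpret prob_space R by fact
  have i: "integrable R f" "integrable R (\<lambda>x. (f x)\<^sup>2)"
    using bdd_measurable_integrable[OF assms(1)] assms(2) bdd_measurable_square[OF assms(2)] by auto
  have "(LINT x|R. f x)\<^sup>2 \<le> (LINT x|R. (f x)\<^sup>2)"
    using variance_positive[of f] variance_eq[OF i] by simp
  then show ?thesis using assms(3,4) power2_le_imp_le order_trans by blast
qed

section \<open>One-sided chaining with brackets\<close>

fun run_min :: "(nat \<Rightarrow> nat \<Rightarrow> 'a \<Rightarrow> real) \<Rightarrow> (nat \<Rightarrow> nat) \<Rightarrow> nat \<Rightarrow> 'a \<Rightarrow> real" where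
  "run_min U c 0 x = U 0 (c 0) x"
| "run_min U c (Suc k) x = min (run_min U c k x) (U (Suc k) (c (Suc k)) x)"

fun chain_step :: "(nat \<Rightarrow> nat \<Rightarrow> 'a \<Rightarrow> real) \<Rightarrow> (nat \<Rightarrow> nat) \<Rightarrow> nat \<Rightarrow> 'a \<Rightarrow> real" where
  "chain_step U c 0 x = U 0 (c 0) x"
| "chain_step U c (Suc k) x = run_min U c (Suc k) x - run_min U c k x"

lemma run_min_cong: "(\<And>i. i \<le> k \<Longrightarrow> c i = c' i) \<Longrightarrow> run_min U c k = run_min U c' k"
  by (induction k) auto

text \<open>A link at level \<open>k\<close> sees only the choices up to level \<open>k\<close>.
  Hence even an infinite class produces at most the product of the \<open>N i\<close> with
  \<open>i \<le> k\<close> distinct links there, and a union bound is possible.\<close>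

lemma chain_step_cong: "(\<And>i. i \<le> k \<Longrightarrow> c i = c' i) \<Longrightarrow> chain_step U c k = chain_step U c' k"
  by (cases k) (auto simp: run_min_cong[of _ c c'] fun_eq_iff)

lemma run_min_eq_sum: "run_min U c k x = (\<Sum>i\<le>k. chain_step U c i x)"
  by (induction k) auto

lemma run_min_le: "i \<le> k \<Longrightarrow> run_min U c k x \<le> U i (c i) x"
  by (induction k) (auto simp: le_Suc_eq min_le_iff_disj)

lemma le_run_min: "(\<And>i. i \<le> k \<Longrightarrow> y \<le> U i (c i) x) \<Longrightarrow> y \<le> run_min U c k x"
  by (induction k) auto

lemma deviation_sum:
  assumes "\<And>i. i \<in> I \<Longrightarrow> integrable R (h i)"
  shows "deviation R n z (\<lambda>x. \<Sum>i\<in>I. h i x) = (\<Sum>i\<in>I. deviation R n z (h i))"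
  unfolding deviation_def using assms
  by (simp add: sum_subtractf sum_divide_distrib Bochner_Integration.integral_sum sum.swap[of _ I])

text \<open>Chaining with brackets, for the upper deviation only: the running minimum of the upper
  brackets decreases, so beyond level 0 only lower tails of nonnegative functions occur.
  These need no bound on their size, and the usual truncation is avoided.\<close>

lemma bracketing_chain:
  fixes N :: "nat \<Rightarrow> nat" and t \<delta> s :: "nat \<Rightarrow> real"
  assumes M: "prob_space M" "iid_sample M R Z" and n: "0 < n"
    and U: "\<And>k j. k \<le> S \<Longrightarrow> j < N k \<Longrightarrow> U k j \<in> bdd_measurable R b"
    and L: "\<And>k j. k \<le> S \<Longrightarrow> j < N k \<Longrightarrow> L k j \<in> bdd_measurable R b"
    and width: "\<And>k j. k \<le> S \<Longrightarrow> j < N k \<Longrightarrow> (LINT x|R. (U k j x - L k j x)\<^sup>2) \<le> (\<delta> k)\<^sup>2"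
    and \<delta>: "\<And>k. 0 \<le> \<delta> k"
    and F: "F \<subseteq> bdd_measurable R b"
    and cover: "\<And>f k. f \<in> F \<Longrightarrow> k \<le> S \<Longrightarrow> \<exists>j<N k. \<forall>x\<in>space R. L k j x \<le> f x \<and> f x \<le> U k j x"
    and s: "\<And>k. 0 < s k" "s 0 * b \<le> 1"
  shows "\<exists>B\<in>sets M. measure M B \<le> (\<Sum>k\<le>S. (\<Prod>i\<le>k. real (N i)) * exp (- t k)) \<and>
     (\<forall>\<omega>\<in>space M - B. \<forall>f\<in>F. deviation R n (\<lambda>i. Z i \<omega>) f \<le>
        s 0 * (2 * (LINT x|R. (f x)\<^sup>2) + 2 * (\<delta> 0)\<^sup>2) + t 0 / (n * s 0)
          + (\<Sum>k<S. s (Suc k) * (\<delta> k)\<^sup>2 + t (Suc k) / (n * s (Suc k))) + \<delta> S)"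
proof -
  interpret prob_space M by fact
  note Z = iid_sampleD[OF M]
  interpret R: prob_space R by (rule Z(3))
  note [measurable] = Z(1)
  have "\<exists>c. \<forall>k\<le>S. c k < N k \<and> (\<forall>x\<in>space R. L k (c k) x \<le> f x \<and> f x \<le> U k (c k) x)" if "f \<in> F" for f
    using cover[OF that] by metis
  then obtain c where c: "\<And>f k. f \<in> F \<Longrightarrow> k \<le> S \<Longrightarrow> c f k < N k"
    and cb: "\<And>f k x. f \<in> F \<Longrightarrow> k \<le> S \<Longrightarrow> x \<in> space R \<Longrightarrow> L k (c f k) x \<le> f x \<and> f x \<le> U k (c f k) x"
    by metis
  have rm: "run_min U (c f) k \<in> bdd_measurable R b" if "f \<in> F" "k \<le> S" for f k
    using that(2)
  proof (induction k)
    case 0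
    then show ?case using U[OF _ c[OF that(1)], of 0] by (simp add: bdd_measurable_def cong: measurable_cong)
  next
    case (Suc k)
    have "(\<lambda>x. run_min U (c f) (Suc k) x) \<in> bdd_measurable R b"
      using Suc U[OF _ c[OF that(1)], of "Suc k"] by (simp add: bdd_measurable_min)
    then show ?case by simp
  qed
  define T where "T k = (\<lambda>f. chain_step U (c f) k) ` F" for k
  have Tsub: "T k \<subseteq> (\<lambda>d. chain_step U d k) ` (PiE {..k} (\<lambda>i. {..<N i}))" if "k \<le> S" for k
  proof
    fix h assume "h \<in> T k"
    then obtain f where f: "f \<in> F" "h = chain_step U (c f) k" by (auto simp: T_def)
    have "h = chain_step U (restrict (c f) {..k}) k"
      unfolding f(2) by (rule chain_step_cong) simp
    moreover have "restrict (c f) {..k} \<in> PiE {..k} (\<lambda>i. {..<N i})"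
      using c[OF f(1)] that by auto
    ultimately show "h \<in> (\<lambda>d. chain_step U d k) ` (PiE {..k} (\<lambda>i. {..<N i}))" by blast
  qed
  have finPi: "finite (PiE {..k} (\<lambda>i. {..<N i}))" for k by (intro finite_PiE) auto
  have Tfin: "finite (T k)" if "k \<le> S" for k
    using Tsub[OF that] finPi by (meson finite_imageI finite_subset)
  have Tcard: "real (card (T k)) \<le> (\<Prod>i\<le>k. real (N i))" if "k \<le> S" for k
  proof -
    have "card (T k) \<le> card (PiE {..k} (\<lambda>i. {..<N i}))"
      using surj_card_le[OF finPi Tsub[OF that]] .
    also have "\<dots> = (\<Prod>i\<le>k. N i)" by (simp add: card_PiE)
    finally show ?thesis by (metis of_nat_le_iff of_nat_prod)
  qed
  have step: "chain_step U (c f) k \<in> bdd_measurable R (2 * b)" if "f \<in> F" "k \<le> S" for f k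
  proof (cases k)
    case 0
    have "\<bar>U 0 (c f 0) x\<bar> \<le> 2 * b" if "x \<in> space R" for x
      using bdd_measurableD(2)[OF U[OF _ c[OF \<open>f \<in> F\<close>], of 0], of x] that by simp
    then show ?thesis using bdd_measurableD(1)[OF U[OF _ c[OF that(1)], of 0]] 0
      by (simp add: bdd_measurable_def cong: measurable_cong)
  next
    case (Suc k')
    have "(\<lambda>x. run_min U (c f) (Suc k') x - run_min U (c f) k' x) \<in> bdd_measurable R (b + b)"
      using bdd_measurable_diff[OF rm[OF that(1)] rm[OF that(1)], of "Suc k'" k'] Suc that by simp
    then show ?thesis using Suc by (simp add: bdd_measurable_def del: run_min.simps cong: measurable_cong)
  qed
  \<comment> \<open>The size condition binds only at level 0. All later links are nonpositive, so
    \<open>s k\<close> is free to grow with \<open>k\<close>.\<close>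
  have upper: "s k * chain_step U (c f) k x \<le> 1" if "f \<in> F" "k \<le> S" "x \<in> space R" for f k x
  proof (cases k)
    case 0
    have "s 0 * U 0 (c f 0) x \<le> s 0 * b"
      using bdd_measurableD(2)[OF U[OF _ c[OF that(1)], of 0] that(3)] s(1)[of 0] by simp
    then show ?thesis using 0 s(2) by simp
  next
    case (Suc k')
    have "s k * chain_step U (c f) k x \<le> 0"
      using s(1)[of k] by (simp add: Suc mult_le_0_iff)
    then show ?thesis by simp
  qed
  define bad where "bad k h = {\<omega>\<in>space M. s k * (LINT x|R. (h x)\<^sup>2) + t k / (n * s k)
     \<le> deviation R n (\<lambda>i. Z i \<omega>) h}" for k h
  define B where "B = (\<Union>k\<in>{..S}. \<Union>h\<in>T k. bad k h)"
  have Th: "\<exists>f\<in>F. h = chain_step U (c f) k" if "h \<in> T k" for h k using that by (auto simp: T_def)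
  have badm: "bad k h \<in> sets M" if "k \<le> S" "h \<in> T k" for k h
  proof -
    have [measurable]: "h \<in> borel_measurable R"
      using Th[OF that(2)] step that(1) bdd_measurableD(1) by blast
    show ?thesis unfolding bad_def deviation_def by measurable
  qed
  have badp: "measure M (bad k h) \<le> exp (- t k)" if kh: "k \<le> S" "h \<in> T k" for k h
  proof -
    obtain f where f: "f \<in> F" "h = chain_step U (c f) k" using Th[OF kh(2)] by blast
    show ?thesis unfolding bad_def
      by (rule chernoff_iid[OF M, where b = "2 * b"]) (use step upper f kh s n in auto)
  qed
  have "measure M B \<le> (\<Sum>k\<le>S. measure M (\<Union>h\<in>T k. bad k h))"
    unfolding B_def using badm Tfin by (intro finite_measure_subadditive_finite) (auto intro!: sets.finite_UN)
  also have "\<dots> \<le> (\<Sum>k\<le>S. (\<Prod>i\<le>k. real (N i)) * exp (- t k))"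
  proof (rule sum_mono)
    fix k assume k: "k \<in> {..S}"
    have "measure M (\<Union>h\<in>T k. bad k h) \<le> (\<Sum>h\<in>T k. measure M (bad k h))"
      using badm Tfin k by (intro finite_measure_subadditive_finite) auto
    also have "\<dots> \<le> real (card (T k)) * exp (- t k)"
      using badp k by (intro sum_bounded_above) auto
    also have "\<dots> \<le> (\<Prod>i\<le>k. real (N i)) * exp (- t k)"
      using Tcard k by (intro mult_right_mono) auto
    finally show "measure M (\<Union>h\<in>T k. bad k h) \<le> (\<Prod>i\<le>k. real (N i)) * exp (- t k)" .
  qed
  finally have MB: "measure M B \<le> (\<Sum>k\<le>S. (\<Prod>i\<le>k. real (N i)) * exp (- t k))" .
  have Bm: "B \<in> sets M" unfolding B_def using badm Tfin by (auto intro!: sets.finite_UN)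
  have "deviation R n (\<lambda>i. Z i \<omega>) f \<le>
        s 0 * (2 * (LINT x|R. (f x)\<^sup>2) + 2 * (\<delta> 0)\<^sup>2) + t 0 / (n * s 0)
          + (\<Sum>k<S. s (Suc k) * (\<delta> k)\<^sup>2 + t (Suc k) / (n * s (Suc k))) + \<delta> S"
    if \<omega>: "\<omega> \<in> space M - B" and f: "f \<in> F" for \<omega> f
  proof -
    let ?h = "chain_step U (c f)" and ?dev = "deviation R n (\<lambda>i. Z i \<omega>)"
    have Zs: "Z i \<omega> \<in> space R" for i using \<omega> measurable_space[OF Z(1)] by auto
    have good: "?dev (?h k) < s k * (LINT x|R. (?h k x)\<^sup>2) + t k / (n * s k)" if "k \<le> S" for k
    proof -
      have "\<omega> \<notin> bad k (?h k)" using \<omega> that f unfolding B_def T_def by auto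
      then show ?thesis using \<omega> unfolding bad_def by auto
    qed
    have fb: "f \<in> bdd_measurable R b" using F f by blast
    have intf: "integrable R f" "integrable R (\<lambda>x. (f x)\<^sup>2)"
      using bdd_measurable_integrable[OF Z(3)] fb bdd_measurable_square[OF fb] by blast+
    have UL: "(\<lambda>x. U k (c f k) x - L k (c f k) x) \<in> bdd_measurable R (b + b)" if "k \<le> S" for k
      using that by (intro bdd_measurable_diff U L c f)
    have intUL: "integrable R (\<lambda>x. (U k (c f k) x - L k (c f k) x)\<^sup>2)" if "k \<le> S" for k
      using bdd_measurable_integrable[OF Z(3) bdd_measurable_square[OF UL[OF that]]] .
    have UL0: "(LINT x|R. (U k (c f k) x - L k (c f k) x)\<^sup>2) \<le> (\<delta> k)\<^sup>2" if "k \<le> S" for k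
      using that by (intro width c f)
    have int_sq: "integrable R (\<lambda>x. (?h k x)\<^sup>2)" if "k \<le> S" for k
      using bdd_measurable_integrable[OF Z(3) bdd_measurable_square[OF step[OF f that]]] .
    have le_rm: "f x \<le> run_min U (c f) k x" if "k \<le> S" "x \<in> space R" for k x
      by (rule le_run_min) (use cb[OF f] that in auto)
    \<comment> \<open>The bracket stands in for \<open>f\<close> at level 0, but its second moment
      is charged to that of \<open>f\<close> plus the squared width, so the leading variance term is
      that of \<open>f\<close> itself.\<close>
    have sq0: "(LINT x|R. (?h 0 x)\<^sup>2) \<le> 2 * (LINT x|R. (f x)\<^sup>2) + 2 * (\<delta> 0)\<^sup>2"
    proof -
      have "(LINT x|R. (?h 0 x)\<^sup>2) \<le> (LINT x|R. 2 * (f x)\<^sup>2 + 2 * (U 0 (c f 0) x - L 0 (c f 0) x)\<^sup>2)"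
      proof (rule integral_mono)
        fix x assume x: "x \<in> space R"
        have "(U 0 (c f 0) x - f x)\<^sup>2 \<le> (U 0 (c f 0) x - L 0 (c f 0) x)\<^sup>2"
          using cb[OF f _ x, of 0] by (intro power_mono) auto
        moreover have "(U 0 (c f 0) x)\<^sup>2 \<le> 2 * (f x)\<^sup>2 + 2 * (U 0 (c f 0) x - f x)\<^sup>2"
          using zero_le_power2[of "2 * f x - U 0 (c f 0) x"] by (simp add: power2_eq_square algebra_simps)
        ultimately show "(?h 0 x)\<^sup>2 \<le> 2 * (f x)\<^sup>2 + 2 * (U 0 (c f 0) x - L 0 (c f 0) x)\<^sup>2" by simp
      qed (use int_sq[of 0] intf intUL[of 0] in auto)
      also have "\<dots> = 2 * (LINT x|R. (f x)\<^sup>2) + 2 * (LINT x|R. (U 0 (c f 0) x - L 0 (c f 0) x)\<^sup>2)"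
        using intf intUL[of 0] by simp
      finally show ?thesis using UL0[of 0] by simp
    qed
    \<comment> \<open>Both running minima are caught between \<open>L k (c f k)\<close> and
      \<open>U k (c f k)\<close>: the later one lies above \<open>f\<close>, the earlier one below
      the upper bracket. The width of the coarser level controls the link, hence
      \<open>\<delta> k\<close> beside \<open>s (Suc k)\<close>.\<close>
    have sqk: "(LINT x|R. (?h (Suc k) x)\<^sup>2) \<le> (\<delta> k)\<^sup>2" if k: "k < S" for k
    proof -
      have "(LINT x|R. (?h (Suc k) x)\<^sup>2) \<le> (LINT x|R. (U k (c f k) x - L k (c f k) x)\<^sup>2)"
      proof (rule integral_mono)
        fix x assume x: "x \<in> space R"
        have "L k (c f k) x \<le> run_min U (c f) (Suc k) x"
          using cb[OF f _ x, of k] le_rm[of "Suc k" x] x k by (meson Suc_leI less_imp_le_nat order_trans)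
        moreover have "run_min U (c f) k x \<le> U k (c f k) x" by (rule run_min_le) simp
        moreover have "run_min U (c f) (Suc k) x \<le> run_min U (c f) k x" by simp
        ultimately have "\<bar>?h (Suc k) x\<bar> \<le> \<bar>U k (c f k) x - L k (c f k) x\<bar>"
          by (simp del: run_min.simps)
        then show "(?h (Suc k) x)\<^sup>2 \<le> (U k (c f k) x - L k (c f k) x)\<^sup>2"
          by (simp only: abs_le_square_iff)
      qed (use int_sq[of "Suc k"] intUL[of k] k in auto)
      also have "\<dots> \<le> (\<delta> k)\<^sup>2" using UL0[of k] k by simp
      finally show ?thesis .
    qed
    \<comment> \<open>Passing from \<open>f\<close> to the last running minimum can only raise the
      empirical mean, so the price is the integral of the difference, with no fluctuation in
      it.\<close>
    have "?dev f \<le> ?dev (run_min U (c f) S) + (LINT x|R. run_min U (c f) S x - f x)"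
    proof -
      have "(\<Sum>i<n. f (Z i \<omega>)) \<le> (\<Sum>i<n. run_min U (c f) S (Z i \<omega>))"
        using le_rm Zs by (intro sum_mono) auto
      then have "(\<Sum>i<n. f (Z i \<omega>)) / n \<le> (\<Sum>i<n. run_min U (c f) S (Z i \<omega>)) / n"
        by (simp add: divide_right_mono)
      then show ?thesis
        using intf bdd_measurable_integrable[OF Z(3) rm[OF f, of S]] by (simp add: deviation_def)
    qed
    moreover have "(LINT x|R. run_min U (c f) S x - f x) \<le> \<delta> S"
    proof -
      have "(LINT x|R. run_min U (c f) S x - f x) \<le> (LINT x|R. U S (c f S) x - L S (c f S) x)"
      proof (rule integral_mono)
        fix x assume x: "x \<in> space R"
        show "run_min U (c f) S x - f x \<le> U S (c f S) x - L S (c f S) x"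
          using run_min_le[of S S U "c f" x] cb[OF f _ x, of S] by auto
      qed (use intf bdd_measurable_integrable[OF Z(3) rm[OF f, of S]]
            bdd_measurable_integrable[OF Z(3) UL[of S]] in auto)
      also have "\<dots> \<le> \<delta> S"
        using integral_le_sqrt_integral_square[OF Z(3) UL[of S] UL0[of S] \<delta>] by simp
      finally show ?thesis .
    qed
    moreover have "?dev (run_min U (c f) S) = (\<Sum>k\<le>S. ?dev (?h k))"
    proof -
      have "?dev (\<lambda>x. \<Sum>k\<le>S. ?h k x) = (\<Sum>k\<le>S. ?dev (?h k))"
        using bdd_measurable_integrable[OF Z(3) step[OF f]] by (intro deviation_sum) auto
      moreover have "run_min U (c f) S = (\<lambda>x. \<Sum>k\<le>S. ?h k x)"
        by (rule ext) (rule run_min_eq_sum)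
      ultimately show ?thesis by simp
    qed
    moreover have "(\<Sum>k\<le>S. ?dev (?h k)) = ?dev (?h 0) + (\<Sum>k<S. ?dev (?h (Suc k)))"
      by (simp add: sum.atMost_shift)
    moreover have "?dev (?h 0) \<le> s 0 * (2 * (LINT x|R. (f x)\<^sup>2) + 2 * (\<delta> 0)\<^sup>2) + t 0 / (n * s 0)"
      using good[of 0] mult_left_mono[OF sq0 less_imp_le[OF s(1)[of 0]]] by linarith
    moreover have "(\<Sum>k<S. ?dev (?h (Suc k))) \<le>
        (\<Sum>k<S. s (Suc k) * (\<delta> k)\<^sup>2 + t (Suc k) / (n * s (Suc k)))"
    proof (rule sum_mono)
      fix k assume "k \<in> {..<S}"
      then have "k < S" "Suc k \<le> S" by auto
      then show "?dev (?h (Suc k)) \<le> s (Suc k) * (\<delta> k)\<^sup>2 + t (Suc k) / (n * s (Suc k))"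
        using good[of "Suc k"] mult_left_mono[OF sqk[of k] less_imp_le[OF s(1)[of "Suc k"]]] by linarith
    qed
    ultimately show ?thesis by linarith
  qed
  then show ?thesis using MB Bm by blast
qed

section \<open>Uniform deviations over dyadic balls\<close>

text \<open>Unlike in \<open>bracketing_number\<close>, the brackets themselves are bounded by
  \<open>b\<close>: the exponential bound is applied to the upper brackets and their running
  minima.\<close>

definition bracket_cover :: "'a measure \<Rightarrow> real \<Rightarrow> real \<Rightarrow> nat \<Rightarrow> ('a \<Rightarrow> real) set \<Rightarrow> bool" where
  "bracket_cover R b \<delta> N F \<longleftrightarrow> (\<exists>L U.
     (\<forall>j<N. L j \<in> bdd_measurable R b \<and> U j \<in> bdd_measurable R b \<and>
        (LINT x|R. (U j x - L j x)\<^sup>2) \<le> \<delta>\<^sup>2) \<and>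
     (\<forall>f\<in>F. \<exists>j<N. \<forall>x\<in>space R. L j x \<le> f x \<and> f x \<le> U j x))"

lemma summable_weighted_geometric:
  fixes q :: real
  assumes "0 \<le> q" "q < 1"
  shows "summable (\<lambda>k. real (k + 1) * q ^ k)"
  using geometric_deriv_sums[of q] assms by (simp add: sums_iff)

text \<open>Since \<open>n * r^2 = r powr (- \<gamma>)\<close>, the log of the number of brackets at
  the coarsest scale is at most \<open>A\<close> times \<open>E = n * r^2\<close>. Level
  \<open>k\<close> raises this bound by the factor \<open>2 powr (\<gamma> * k)\<close>. Balancing
  variance against tail there leaves a term of order \<open>(k + 1) * q ^ k\<close>, and \<gamma> <
  2 gives \<open>q < 1\<close>.\<close>

lemma class_deviation:
  assumes M: "prob_space M" "iid_sample M R Z" and n: "0 < n"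
    and \<gamma>: "0 < \<gamma>" "\<gamma> < 2" and A: "0 \<le> A" and \<kappa>: "0 < \<kappa>" "\<kappa> * K \<le> 1" and W: "0 < W" and a: "1 \<le> a"
    and F: "F \<subseteq> bdd_measurable R (K * W)"
    and cover: "\<And>\<delta>. 0 < \<delta> \<Longrightarrow> \<exists>N. real N \<le> exp (A * (W / \<delta>) powr \<gamma>) \<and> bracket_cover R (K * W) \<delta> N F"
  shows "\<exists>B\<in>sets M. measure M B \<le> 2 * exp (- a) \<and> (\<forall>\<omega>\<in>space M - B. \<forall>f\<in>F.
     deviation R n (\<lambda>i. Z i \<omega>) f \<le> 2 * \<kappa> / W * (LINT x|R. (f x)\<^sup>2) +
       (A + 5) * (2 * \<kappa> + 1 / \<kappa> + (\<Sum>k. real (k + 1) * (2 powr (\<gamma> / 2) / 2) ^ k) + 1) * a * W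
         * n powr (- 2 / (2 + \<gamma>)))"
proof -
  define r where "r = real n powr (- 1 / (2 + \<gamma>))"
  define E where "E = real n * r\<^sup>2"
  define p where "p = 2 powr (\<gamma> / 2)"
  define q where "q = p / 2"
  define \<delta> where "\<delta> k = W * r / 2 ^ k" for k :: nat
  \<comment> \<open>\<open>s 0\<close> must respect the sup bound \<open>K * W\<close> and fixes the
    coefficient of the second moment. At level \<open>k > 0\<close> the choice makes the variance
    term, with the width of level \<open>k - 1\<close>, and the tail term both of order
    \<open>W * r^2 * q ^ k\<close>, up to factors from \<open>t\<close>.\<close>
  define s where "s k = (if k = 0 then \<kappa> / W else 2 ^ k * p ^ k / W)" for k :: nat
  \<comment> \<open>The factor \<open>k + 1\<close> accounts for the levels \<open>0..k\<close>
    whose choices enter a link. The part with \<open>A\<close> cancels the number of links; the part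
    with \<open>a\<close> makes the failure probabilities summable.\<close>
  define t where "t k = E * real (k + 1) * (p\<^sup>2) ^ k * (A + a)" for k :: nat
  define G where "G = (\<Sum>k. real (k + 1) * q ^ k)"
  have n1: "1 \<le> real n" using n by simp
  have r: "0 < r" "r \<le> 1"
    using n1 \<gamma> powr_mono[of "- 1 / (2 + \<gamma>)" 0 "real n"] by (auto simp: r_def)
  have r2: "r\<^sup>2 = real n powr (- 2 / (2 + \<gamma>))"
    using n1 by (simp add: r_def powr_power mult.commute)
  have E: "E = (1 / r) powr \<gamma>"
  proof -
    have "E = real n powr (1 + - 2 / (2 + \<gamma>))" using n1 unfolding E_def r2 powr_add by simp
    also have "1 + - 2 / (2 + \<gamma>) = 1 / (2 + \<gamma>) * \<gamma>" using \<gamma> by (simp add: field_simps)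
    also have "real n powr \<dots> = (real n powr (1 / (2 + \<gamma>))) powr \<gamma>" by (simp add: powr_powr)
    also have "real n powr (1 / (2 + \<gamma>)) = 1 / r"
      using n1 by (simp add: r_def powr_minus_divide)
    finally show ?thesis .
  qed
  have E1: "1 \<le> E" using r \<gamma> unfolding E by (intro ge_one_powr_ge_zero) auto
  have p: "1 \<le> p" "p < 2" "0 < p" "p\<^sup>2 = 2 powr \<gamma>"
  proof -
    show "1 \<le> p" using \<gamma> unfolding p_def by (intro ge_one_powr_ge_zero) auto
    then show "0 < p" by simp
    show "p < 2" using powr_less_mono[of "\<gamma> / 2" 1 2] \<gamma> unfolding p_def by simp
    show "p\<^sup>2 = 2 powr \<gamma>" unfolding p_def by (simp add: powr_power)
  qed
  have p2: "1 \<le> p\<^sup>2" using p(1) by (rule one_le_power)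
  have q: "0 \<le> q" "q < 1" using p by (auto simp: q_def)
  have \<delta>pos: "0 < \<delta> k" for k using W r by (simp add: \<delta>_def)
  have spos: "0 < s k" for k using W p \<kappa> by (simp add: s_def)
  have powk: "(W / \<delta> k) powr \<gamma> = (p\<^sup>2) ^ k * E" for k
  proof -
    have "W / \<delta> k = 2 ^ k * (1 / r)" using W r by (simp add: \<delta>_def)
    then have "(W / \<delta> k) powr \<gamma> = (2 ^ k) powr \<gamma> * E" using r E by (simp only: powr_mult)
    also have "(2 ^ k :: real) powr \<gamma> = (2 powr \<gamma>) ^ k"
      by (simp add: powr_powr powr_power mult.commute flip: powr_realpow)
    finally show ?thesis using p by simp
  qed
  have "\<exists>N. real N \<le> exp (A * ((p\<^sup>2) ^ k * E)) \<and> bracket_cover R (K * W) (\<delta> k) N F" for k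
    using cover[OF \<delta>pos[of k]] unfolding powk .
  then obtain N where N: "\<And>k. real (N k) \<le> exp (A * ((p\<^sup>2) ^ k * E))"
    and bc: "\<And>k. bracket_cover R (K * W) (\<delta> k) (N k) F"
    by metis
  define is_cover where "is_cover k L U \<longleftrightarrow>
     (\<forall>j<N k. L j \<in> bdd_measurable R (K * W) \<and> U j \<in> bdd_measurable R (K * W) \<and>
        (LINT x|R. (U j x - L j x)\<^sup>2) \<le> (\<delta> k)\<^sup>2) \<and>
     (\<forall>f\<in>F. \<exists>j<N k. \<forall>x\<in>space R. L j x \<le> f x \<and> f x \<le> U j x)" for k L U
  have "\<exists>L U. is_cover k L U" for k
    using bc[of k] unfolding bracket_cover_def is_cover_def .
  then obtain L U where "\<And>k. is_cover k (L k) (U k)" by metis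
  then have br: "\<And>k j. j < N k \<Longrightarrow> L k j \<in> bdd_measurable R (K * W) \<and> U k j \<in> bdd_measurable R (K * W) \<and>
        (LINT x|R. (U k j x - L k j x)\<^sup>2) \<le> (\<delta> k)\<^sup>2"
    and cov: "\<And>k f. f \<in> F \<Longrightarrow> \<exists>j<N k. \<forall>x\<in>space R. L k j x \<le> f x \<and> f x \<le> U k j x"
    unfolding is_cover_def by blast+
  \<comment> \<open>The depth depends on \<open>n\<close>: refinement stops once the relative width
    has dropped by the factor \<open>r\<close>, so that the final bias \<open>\<delta> S\<close> is
    at most \<open>W * r^2\<close>.\<close>
  obtain S where S: "(1 / 2) ^ S < r"
    using real_arch_pow_inv[of r "1 / 2"] r by auto
  have "\<exists>B\<in>sets M. measure M B \<le> (\<Sum>k\<le>S. (\<Prod>i\<le>k. real (N i)) * exp (- t k)) \<and>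
     (\<forall>\<omega>\<in>space M - B. \<forall>f\<in>F. deviation R n (\<lambda>i. Z i \<omega>) f \<le>
        s 0 * (2 * (LINT x|R. (f x)\<^sup>2) + 2 * (\<delta> 0)\<^sup>2) + t 0 / (n * s 0)
          + (\<Sum>k<S. s (Suc k) * (\<delta> k)\<^sup>2 + t (Suc k) / (n * s (Suc k))) + \<delta> S)"
  proof (rule bracketing_chain[where U = U and L = L and N = N, OF M n])
    show "s 0 * (K * W) \<le> 1" using W \<kappa> by (simp add: s_def)
    show "0 \<le> \<delta> k" for k using \<delta>pos[of k] by simp
  qed (use br cov F spos in blast)+
  then obtain B where B: "B \<in> sets M"
    and MB: "measure M B \<le> (\<Sum>k\<le>S. (\<Prod>i\<le>k. real (N i)) * exp (- t k))"
    and dev: "\<And>\<omega> f. \<omega> \<in> space M - B \<Longrightarrow> f \<in> F \<Longrightarrow> deviation R n (\<lambda>i. Z i \<omega>) f \<le>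
        s 0 * (2 * (LINT x|R. (f x)\<^sup>2) + 2 * (\<delta> 0)\<^sup>2) + t 0 / (n * s 0)
          + (\<Sum>k<S. s (Suc k) * (\<delta> k)\<^sup>2 + t (Suc k) / (n * s (Suc k))) + \<delta> S"
    by blast
  note MB
  also have "(\<Sum>k\<le>S. (\<Prod>i\<le>k. real (N i)) * exp (- t k)) \<le> (\<Sum>k\<le>S. exp (- a) * (1 / 2) ^ k)"
  proof (rule sum_mono)
    fix k
    have "(\<Prod>i\<le>k. real (N i)) \<le> (\<Prod>i\<le>k. exp (A * ((p\<^sup>2) ^ i * E)))"
      by (intro prod_mono conjI N) auto
    also have "\<dots> = exp (\<Sum>i\<le>k. A * ((p\<^sup>2) ^ i * E))" by (simp add: exp_sum)
    also have "(\<Sum>i\<le>k. A * ((p\<^sup>2) ^ i * E)) \<le> (\<Sum>i\<le>k. A * ((p\<^sup>2) ^ k * E))"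
      using A E1 p2 by (intro sum_mono mult_left_mono mult_right_mono power_increasing) auto
    also have "\<dots> = E * real (k + 1) * (p\<^sup>2) ^ k * A" by (simp add: algebra_simps)
    finally have "(\<Prod>i\<le>k. real (N i)) * exp (- t k) \<le> exp (E * real (k + 1) * (p\<^sup>2) ^ k * A) * exp (- t k)"
      by (intro mult_right_mono) auto
    also have "\<dots> = exp (- (E * (p\<^sup>2) ^ k * (real (k + 1) * a)))"
      by (simp add: t_def algebra_simps flip: exp_add)
    also have "\<dots> \<le> exp (- (a + k))"
    proof -
      have "1 \<le> E * (p\<^sup>2) ^ k" using E1 p2 mult_mono[of 1 E 1 "(p\<^sup>2) ^ k"] by (simp add: one_le_power)
      moreover have "a + k \<le> real (k + 1) * a"
        using a mult_left_mono[of 1 a "real k"] by (simp add: algebra_simps)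
      ultimately have "1 * (a + k) \<le> E * (p\<^sup>2) ^ k * (real (k + 1) * a)"
        using a by (intro mult_mono) auto
      then show ?thesis by simp
    qed
    also have "\<dots> = exp (- a) * exp (- 1) ^ k"
      by (simp add: exp_add[symmetric] flip: exp_of_nat_mult)
    also have "\<dots> \<le> exp (- a) * (1 / 2) ^ k"
    proof -
      have "exp (- 1 :: real) \<le> 1 / 2"
        using exp_ge_add_one_self[of 1] by (simp add: exp_minus field_simps)
      then show ?thesis by (intro mult_left_mono power_mono) auto
    qed
    finally show "(\<Prod>i\<le>k. real (N i)) * exp (- t k) \<le> exp (- a) * (1 / 2) ^ k" .
  qed
  also have "\<dots> = exp (- a) * (\<Sum>k\<le>S. (1 / 2) ^ k)" by (simp add: sum_distrib_left)
  also have "\<dots> \<le> exp (- a) * 2"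
  proof (rule mult_left_mono)
    have "(\<Sum>k\<le>m. (1 / 2) ^ k) = 2 - (1 / 2 :: real) ^ m" for m
      by (induction m) auto
    then show "(\<Sum>k\<le>S. (1 / 2) ^ k) \<le> (2 :: real)" by simp
  qed simp
  finally have MB': "measure M B \<le> 2 * exp (- a)" by simp
  have c0: "s 0 * (2 * (\<delta> 0)\<^sup>2) = W * r\<^sup>2 * (2 * \<kappa>)"
    using W by (simp add: s_def \<delta>_def power2_eq_square)
  have c1: "t 0 / (n * s 0) = W * r\<^sup>2 * ((A + a) / \<kappa>)"
    using W n \<kappa> by (simp add: t_def E_def s_def field_simps)
  have c2: "s (Suc k) * (\<delta> k)\<^sup>2 + t (Suc k) / (n * s (Suc k)) \<le>
     W * r\<^sup>2 * (A + a + 4) * (real (Suc k + 1) * q ^ Suc k)" for k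
  proof -
    have "s (Suc k) * (\<delta> k)\<^sup>2 = (2 ^ Suc k * p ^ Suc k / W) * (W * r / 2 ^ k)\<^sup>2"
      by (simp add: s_def \<delta>_def)
    also have "\<dots> = W * r\<^sup>2 * 4 * q ^ Suc k"
      using W by (simp add: q_def field_simps power2_eq_square)
    also have "\<dots> \<le> W * r\<^sup>2 * 4 * (real (Suc k + 1) * q ^ Suc k)"
      using W q mult_right_mono[of 1 "real (Suc k + 1)" "q ^ Suc k"] by (intro mult_left_mono) auto
    finally have 1: "s (Suc k) * (\<delta> k)\<^sup>2 \<le> W * r\<^sup>2 * 4 * (real (Suc k + 1) * q ^ Suc k)" .
    have "t (Suc k) / (n * s (Suc k)) =
        (n * r\<^sup>2 * real (Suc k + 1) * (p ^ Suc k * p ^ Suc k) * (A + a)) / (n * (2 ^ Suc k * p ^ Suc k / W))"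
      by (simp only: t_def E_def s_def power_mult_distrib[symmetric] power2_eq_square nat.distinct if_False)
    also have "\<dots> = W * r\<^sup>2 * (A + a) * (real (Suc k + 1) * (p ^ Suc k / 2 ^ Suc k))"
      using W n p by (simp add: divide_simps)
    also have "p ^ Suc k / 2 ^ Suc k = q ^ Suc k" by (simp only: q_def power_divide)
    finally show ?thesis using 1 by (simp add: algebra_simps)
  qed
  have c3: "(\<Sum>k<S. s (Suc k) * (\<delta> k)\<^sup>2 + t (Suc k) / (n * s (Suc k))) \<le> W * r\<^sup>2 * ((A + a + 4) * G)"
  proof -
    have "(\<Sum>k<S. s (Suc k) * (\<delta> k)\<^sup>2 + t (Suc k) / (n * s (Suc k))) \<le>
        (\<Sum>k<S. W * r\<^sup>2 * (A + a + 4) * (real (Suc k + 1) * q ^ Suc k))"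
      by (intro sum_mono c2)
    also have "\<dots> = W * r\<^sup>2 * (A + a + 4) * (\<Sum>k<S. real (Suc k + 1) * q ^ Suc k)"
      by (simp only: sum_distrib_left)
    also have "\<dots> \<le> W * r\<^sup>2 * (A + a + 4) * G"
    proof (rule mult_left_mono)
      have "(\<Sum>k<S. real (Suc k + 1) * q ^ Suc k) \<le> (\<Sum>k<Suc S. real (k + 1) * q ^ k)"
        by (simp add: sum.lessThan_Suc_shift del: sum.lessThan_Suc)
      also have "\<dots> \<le> G"
        unfolding G_def using q by (intro sum_le_suminf summable_weighted_geometric) auto
      finally show "(\<Sum>k<S. real (Suc k + 1) * q ^ Suc k) \<le> G" .
    qed (use W A a in auto)
    finally show ?thesis by (simp add: mult.assoc)
  qed
  have c4: "\<delta> S \<le> W * r\<^sup>2 * 1"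
    using W r S by (simp add: \<delta>_def power2_eq_square power_one_over field_simps)
  have G0: "0 \<le> G" unfolding G_def using q by (intro suminf_nonneg summable_weighted_geometric) auto
  \<comment> \<open>A bound linear in \<open>a\<close> is wanted, so that on ball \<open>j\<close>
    the value \<open>a + j\<close> can be substituted for \<open>a\<close> with the same
    constant.\<close>
  have Aa: "A + a + 4 \<le> (A + 5) * a"
    using A a mult_left_mono[of 1 a "A + 4"] by (simp add: algebra_simps)
  have a': "1 \<le> (A + 5) * a" using A a by (intro order.trans[OF _ Aa]) auto
  have "deviation R n (\<lambda>i. Z i \<omega>) f \<le> 2 * \<kappa> / W * (LINT x|R. (f x)\<^sup>2) +
       (A + 5) * (2 * \<kappa> + 1 / \<kappa> + G + 1) * a * W * r\<^sup>2"
    if "\<omega> \<in> space M - B" "f \<in> F" for \<omega> f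
  proof -
    have "deviation R n (\<lambda>i. Z i \<omega>) f \<le> 2 * s 0 * (LINT x|R. (f x)\<^sup>2) +
        W * r\<^sup>2 * (2 * \<kappa> + (A + a) / \<kappa> + (A + a + 4) * G + 1)"
      using dev[OF that] c0 c1 c3 c4 by (simp add: distrib_left)
    also have "W * r\<^sup>2 * (2 * \<kappa> + (A + a) / \<kappa> + (A + a + 4) * G + 1) \<le>
        W * r\<^sup>2 * ((A + 5) * a * (2 * \<kappa>) + (A + 5) * a * (1 / \<kappa>) + (A + 5) * a * G + (A + 5) * a * 1)"
      using W \<kappa> a' Aa G0 a A
      by (intro mult_left_mono add_mono) (auto simp: divide_right_mono intro!: mult_right_mono)
    finally show ?thesis by (simp add: s_def algebra_simps)
  qed
  then show ?thesis using B MB' unfolding r2 G_def q_def p_def by blast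
qed

text \<open>The union over the dyadic balls costs one logarithmic factor \<open>j\<close>.\<close>

lemma dyadic_deviation:
  fixes F :: "nat \<Rightarrow> ('a \<Rightarrow> real) set"
  assumes M: "prob_space M" "iid_sample M R Z"
    and \<gamma>: "0 < \<gamma>" "\<gamma> < 2" and A: "0 \<le> A" and \<kappa>: "0 < \<kappa>" "\<kappa> * K \<le> 1"
    and F: "\<And>j. F j \<subseteq> bdd_measurable R (K * 2 ^ j)"
    and cover: "\<And>j \<delta>. 0 < \<delta> \<Longrightarrow>
      \<exists>N. real N \<le> exp (A * (2 ^ j / \<delta>) powr \<gamma>) \<and> bracket_cover R (K * 2 ^ j) \<delta> N (F j)"
  shows "\<exists>T\<ge>0. \<forall>a\<ge>1. \<forall>n\<ge>1. \<exists>B\<in>sets M. measure M B \<le> 4 * exp (- a) \<and>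
     (\<forall>\<omega>\<in>space M - B. \<forall>j. \<forall>f\<in>F j. deviation R n (\<lambda>i. Z i \<omega>) f \<le>
        2 * \<kappa> / 2 ^ j * (LINT x|R. (f x)\<^sup>2) + T * (a + j) * 2 ^ j * n powr (- 2 / (2 + \<gamma>)))"
proof -
  interpret prob_space M by fact
  define T where "T = (A + 5) * (2 * \<kappa> + 1 / \<kappa> + (\<Sum>k. real (k + 1) * (2 powr (\<gamma> / 2) / 2) ^ k) + 1)"
  have "2 powr (\<gamma> / 2) < (2 :: real)"
    using powr_less_mono[of "\<gamma> / 2" 1 2] \<gamma> by simp
  then have T: "0 \<le> T"
    unfolding T_def using A \<kappa> by (intro mult_nonneg_nonneg add_nonneg_nonneg suminf_nonneg summable_weighted_geometric) auto
  have "\<exists>B\<in>sets M. measure M B \<le> 4 * exp (- a) \<and>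
     (\<forall>\<omega>\<in>space M - B. \<forall>j. \<forall>f\<in>F j. deviation R n (\<lambda>i. Z i \<omega>) f \<le>
        2 * \<kappa> / 2 ^ j * (LINT x|R. (f x)\<^sup>2) + T * (a + j) * 2 ^ j * n powr (- 2 / (2 + \<gamma>)))"
    if a: "1 \<le> a" and n: "1 \<le> n" for a :: real and n :: nat
  proof -
    \<comment> \<open>Using \<open>a + j\<close> on ball \<open>j\<close> makes the failure
      probabilities decay at least like \<open>(1 / 2) ^ j\<close>, so that their sum is at most
      \<open>4 * exp (- a)\<close>.\<close>
    define good where "good j B \<longleftrightarrow> B \<in> sets M \<and> measure M B \<le> 2 * exp (- (a + j)) \<and>
        (\<forall>\<omega>\<in>space M - B. \<forall>f\<in>F j. deviation R n (\<lambda>i. Z i \<omega>) f \<le>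
          2 * \<kappa> / 2 ^ j * (LINT x|R. (f x)\<^sup>2) + T * (a + j) * 2 ^ j * n powr (- 2 / (2 + \<gamma>)))"
      for j :: nat and B
    have "\<exists>B. good j B" for j
      unfolding good_def T_def Bex_def[symmetric]
      by (rule class_deviation[OF M _ \<gamma> A \<kappa> _ _ F cover]) (use a n in auto)
    then obtain B where "\<And>j. good j (B j)" by metis
    then have B: "\<And>j. B j \<in> sets M" "\<And>j. measure M (B j) \<le> 2 * exp (- (a + j))"
      and dev: "\<And>j \<omega> f. \<omega> \<in> space M - B j \<Longrightarrow> f \<in> F j \<Longrightarrow>
        deviation R n (\<lambda>i. Z i \<omega>) f \<le> 2 * \<kappa> / 2 ^ j * (LINT x|R. (f x)\<^sup>2) +
        T * (a + j) * 2 ^ j * n powr (- 2 / (2 + \<gamma>))"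
      unfolding good_def by blast+
    have e: "exp (- 1 :: real) \<le> 1 / 2"
      using exp_ge_add_one_self[of 1] by (simp add: exp_minus field_simps)
    have Bj: "measure M (B j) \<le> 2 * exp (- a) * (1 / 2) ^ j" for j
    proof -
      have "exp (- (a + j)) = exp (- a) * exp (- 1) ^ j"
        by (simp add: exp_add[symmetric] flip: exp_of_nat_mult)
      also have "\<dots> \<le> exp (- a) * (1 / 2) ^ j"
        using e by (intro mult_left_mono power_mono) auto
      finally show ?thesis using B(2)[of j] by simp
    qed
    have geo: "summable (\<lambda>j. 2 * exp (- a) * (1 / 2 :: real) ^ j)"
      by (intro summable_mult summable_geometric) simp
    have sm: "summable (\<lambda>j. measure M (B j))"
      by (rule summable_comparison_test'[OF geo, of 0]) (use Bj in auto)
    have "measure M (\<Union>j. B j) \<le> (\<Sum>j. measure M (B j))"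
      using B(1) sm by (intro finite_measure_subadditive_countably) auto
    also have "\<dots> \<le> (\<Sum>j. 2 * exp (- a) * (1 / 2) ^ j)"
      by (intro suminf_le Bj sm geo)
    also have "\<dots> = 4 * exp (- a)"
      by (subst suminf_mult) (auto simp: suminf_geometric intro!: summable_geometric)
    finally show ?thesis using B(1) dev by (intro bexI[of _ "\<Union>j. B j"]) auto
  qed
  then show ?thesis using T by blast
qed

section \<open>Brackets for transformed classes\<close>

text \<open>A finite infimum of a set of \<open>enat\<close> is attained, so an entropy bound yields
  actual brackets. \<open>N = 0\<close> is split off because \<open>exp_ln\<close> needs a positive
  argument.\<close>

lemma entropy_brackets:
  assumes "bracketing_entropy Q \<delta> G \<le> ereal h" "0 \<le> h"
  shows "\<exists>N L U. real N \<le> exp h \<and>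
     (\<forall>j<N. L j \<in> borel_measurable Q \<and> U j \<in> borel_measurable Q \<and>
        integrable Q (\<lambda>x. (U j x - L j x)\<^sup>2) \<and> sqrt (LINT x|Q. (U j x - L j x)\<^sup>2) \<le> \<delta>) \<and>
     (\<forall>g\<in>G. \<exists>j<N. \<forall>x\<in>space Q. L j x \<le> g x \<and> g x \<le> U j x)"
proof -
  obtain N where N: "bracketing_number Q \<delta> G = enat N"
    using assms(1) unfolding bracketing_entropy_def by (cases "bracketing_number Q \<delta> G") auto
  have "real N \<le> exp h"
  proof (cases "N = 0")
    case False
    moreover have "ln (real N) \<le> h" using assms(1) N by (simp add: bracketing_entropy_def)
    ultimately show ?thesis by (metis exp_le_cancel_iff exp_ln gr0I of_nat_0_less_iff)
  qed simp
  let ?S = "{enat N | N. \<exists>fL fU :: nat \<Rightarrow> 'a \<Rightarrow> real.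
     (\<forall>j<N. fL j \<in> borel_measurable Q \<and> fU j \<in> borel_measurable Q \<and>
        integrable Q (\<lambda>x. (fU j x - fL j x)\<^sup>2) \<and>
        sqrt (LINT x|Q. (fU j x - fL j x)\<^sup>2) \<le> \<delta>) \<and>
     (\<forall>f\<in>G. \<exists>j<N. \<forall>x\<in>space Q. fL j x \<le> f x \<and> f x \<le> fU j x)}"
  have Inf: "Inf ?S = enat N" using N unfolding bracketing_number_def .
  have "?S \<noteq> {}"
  proof
    assume "?S = {}"
    then have "Inf ?S = \<infinity>" by (simp only: Inf_enat_def simp_thms if_True)
    then show False using Inf by simp
  qed
  then have "Inf ?S \<in> ?S" using LeastI_ex[of "\<lambda>k. k \<in> ?S"] by (auto simp only: Inf_enat_def if_False ex_in_conv)
  then have "enat N \<in> ?S" unfolding Inf .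
  then show ?thesis using \<open>real N \<le> exp h\<close> by blast
qed

text \<open>For \<open>0 \<le> b\<close> this is the projection onto \<open>[-b, b]\<close>. Being
  monotone and 1-Lipschitz, it bounds brackets without widening them, and still covers every
  function with values in that interval.\<close>

definition clip :: "real \<Rightarrow> real \<Rightarrow> real" where
  "clip b y = max (- b) (min b y)"

lemma clip_mono: "x \<le> y \<Longrightarrow> clip b x \<le> clip b y"
  and clip_id: "\<bar>x\<bar> \<le> b \<Longrightarrow> clip b x = x"
  and abs_clip_le: "0 \<le> b \<Longrightarrow> \<bar>clip b x\<bar> \<le> b"
  and clip_lipschitz: "\<bar>clip b x - clip b y\<bar> \<le> \<bar>x - y\<bar>"
  by (auto simp: clip_def)

lemma borel_measurable_clip [measurable]: "clip b \<in> borel_measurable borel"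
  unfolding clip_def by measurable

text \<open>The min/max condition lets \<open>\<Phi> x\<close> be increasing or decreasing, depending on \<open>x\<close>.\<close>

lemma bracket_cover_compose:
  assumes R: "sets R = sets Q"
    and dom: "\<And>w. (\<And>x. x \<in> space Q \<Longrightarrow> 0 \<le> w x) \<Longrightarrow> integrable Q w \<Longrightarrow>
      integrable R w \<and> (LINT x|R. w x) \<le> \<eta> * (LINT x|Q. w x)"
    and meas: "\<And>g. g \<in> borel_measurable Q \<Longrightarrow> (\<lambda>x. \<Phi> x (g x)) \<in> borel_measurable Q"
    and lip: "\<And>x u v. x \<in> space Q \<Longrightarrow> 0 \<le> u \<Longrightarrow> 0 \<le> v \<Longrightarrow> \<bar>\<Phi> x u - \<Phi> x v\<bar> \<le> \<Lambda> * \<bar>u - v\<bar>"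
    and btw: "\<And>x u y v. x \<in> space Q \<Longrightarrow> 0 \<le> u \<Longrightarrow> u \<le> y \<Longrightarrow> y \<le> v \<Longrightarrow>
      min (\<Phi> x u) (\<Phi> x v) \<le> \<Phi> x y \<and> \<Phi> x y \<le> max (\<Phi> x u) (\<Phi> x v)"
    and nonneg: "0 \<le> \<eta>" "0 \<le> \<Lambda>" "0 \<le> b" "0 \<le> \<delta>"
    and G: "\<And>g x. g \<in> G \<Longrightarrow> x \<in> space Q \<Longrightarrow> 0 \<le> g x \<and> \<bar>\<Phi> x (g x)\<bar> \<le> b"
    and L: "\<And>j. j < N \<Longrightarrow> L j \<in> borel_measurable Q"
    and U: "\<And>j. j < N \<Longrightarrow> U j \<in> borel_measurable Q"
    and width: "\<And>j. j < N \<Longrightarrow> integrable Q (\<lambda>x. (U j x - L j x)\<^sup>2) \<and>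
      sqrt (LINT x|Q. (U j x - L j x)\<^sup>2) \<le> \<delta>"
    and cover: "\<And>g. g \<in> G \<Longrightarrow> \<exists>j<N. \<forall>x\<in>space Q. L j x \<le> g x \<and> g x \<le> U j x"
  shows "bracket_cover R b (sqrt \<eta> * \<Lambda> * \<delta>) N ((\<lambda>g x. \<Phi> x (g x)) ` G)"
proof -
  have sp: "space R = space Q" using R by (rule sets_eq_imp_space_eq)
  have meas_eq: "borel_measurable R = borel_measurable Q" using R by (intro measurable_cong_sets) auto
  \<comment> \<open>\<Phi> is controlled only at nonnegative arguments, so the brackets are first
    raised to 0; the covered functions are nonnegative and stay inside.\<close>
  define l u where "l j x = \<Phi> x (max 0 (L j x))" and "u j x = \<Phi> x (max 0 (U j x))" for j x
  \<comment> \<open>Where \<open>\<Phi> x\<close> decreases, the images of the two ends swap;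
    minimum and maximum restore their order before clipping.\<close>
  define L' U' where "L' j x = clip b (min (l j x) (u j x))"
    and "U' j x = clip b (max (l j x) (u j x))" for j x
  have lu [measurable]: "l j \<in> borel_measurable R" "u j \<in> borel_measurable R" if "j < N" for j
    using L[OF that] U[OF that] unfolding l_def u_def meas_eq by (auto intro!: meas)
  have L'm: "L' j \<in> bdd_measurable R b" and U'm: "U' j \<in> bdd_measurable R b" if "j < N" for j
    using lu[OF that] abs_clip_le[OF nonneg(3)] unfolding bdd_measurable_def L'_def[abs_def] U'_def[abs_def]
    by (auto intro!: measurable_compose[OF _ borel_measurable_clip])
  \<comment> \<open>Raising to 0, sorting and clipping do not widen a bracket; \<Phi> stretches it
    by at most \<open>\<Lambda>\<close>, and the change of measure multiplies the squared width by
    at most \<open>\<eta>\<close>.\<close>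
  have W: "(LINT x|R. (U' j x - L' j x)\<^sup>2) \<le> (sqrt \<eta> * \<Lambda> * \<delta>)\<^sup>2" if j: "j < N" for j
  proof -
    have le: "(U' j x - L' j x)\<^sup>2 \<le> \<Lambda>\<^sup>2 * (U j x - L j x)\<^sup>2" if x: "x \<in> space R" for x
    proof -
      have "\<bar>U' j x - L' j x\<bar> \<le> \<bar>max (l j x) (u j x) - min (l j x) (u j x)\<bar>"
        unfolding U'_def L'_def by (rule clip_lipschitz)
      also have "\<dots> = \<bar>u j x - l j x\<bar>" by auto
      also have "\<dots> \<le> \<Lambda> * \<bar>max 0 (U j x) - max 0 (L j x)\<bar>"
        unfolding u_def l_def by (rule lip) (use x sp in auto)
      also have "\<dots> \<le> \<Lambda> * \<bar>U j x - L j x\<bar>"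
        using nonneg by (intro mult_left_mono) auto
      finally have "\<bar>U' j x - L' j x\<bar>\<^sup>2 \<le> (\<Lambda> * \<bar>U j x - L j x\<bar>)\<^sup>2" by (intro power_mono) auto
      then show ?thesis by (simp add: power_mult_distrib)
    qed
    have int: "integrable Q (\<lambda>x. \<Lambda>\<^sup>2 * (U j x - L j x)\<^sup>2)" using width[OF j] by simp
    note d = dom[OF _ int]
    have "(LINT x|R. (U' j x - L' j x)\<^sup>2) \<le> (LINT x|R. \<Lambda>\<^sup>2 * (U j x - L j x)\<^sup>2)"
    proof (rule integral_mono')
      show "integrable R (\<lambda>x. \<Lambda>\<^sup>2 * (U j x - L j x)\<^sup>2)" using d by simp
    qed (use le in auto)
    also have "\<dots> \<le> \<eta> * (LINT x|Q. \<Lambda>\<^sup>2 * (U j x - L j x)\<^sup>2)" using d by simp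
    also have "\<dots> = \<eta> * \<Lambda>\<^sup>2 * (LINT x|Q. (U j x - L j x)\<^sup>2)" by simp
    also have "\<dots> \<le> \<eta> * \<Lambda>\<^sup>2 * \<delta>\<^sup>2"
      using width[OF j] nonneg by (intro mult_left_mono) (auto dest: sqrt_le_D)
    finally show ?thesis using nonneg by (simp add: power_mult_distrib)
  qed
  have C: "\<exists>j<N. \<forall>x\<in>space R. L' j x \<le> \<Phi> x (g x) \<and> \<Phi> x (g x) \<le> U' j x" if g: "g \<in> G" for g
  proof -
    obtain j where j: "j < N" "\<And>x. x \<in> space Q \<Longrightarrow> L j x \<le> g x \<and> g x \<le> U j x"
      using cover[OF g] by blast
    have "L' j x \<le> \<Phi> x (g x) \<and> \<Phi> x (g x) \<le> U' j x" if x: "x \<in> space R" for x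
    proof -
      have "min (l j x) (u j x) \<le> \<Phi> x (g x) \<and> \<Phi> x (g x) \<le> max (l j x) (u j x)"
        unfolding l_def u_def using j(2)[of x] G[OF g, of x] x sp by (intro btw) auto
      then have "L' j x \<le> clip b (\<Phi> x (g x)) \<and> clip b (\<Phi> x (g x)) \<le> U' j x"
        unfolding L'_def U'_def by (auto intro: clip_mono)
      then show ?thesis using G[OF g, of x] x sp by (simp add: clip_id)
    qed
    then show ?thesis using j(1) by blast
  qed
  show ?thesis unfolding bracket_cover_def
    by (rule exI[of _ L'], rule exI[of _ U']) (use L'm U'm W C in auto)
qed

section \<open>Hellinger distance to the midpoint\<close>

text \<open>Twice the squared Hellinger distance between \<open>g0\<close> and the midpoint.\<close>

definition midpoint_gap :: "'a measure \<Rightarrow> ('a \<Rightarrow> real) \<Rightarrow> ('a \<Rightarrow> real) \<Rightarrow> real" where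
  "midpoint_gap Q g0 g = (LINT x|Q. (sqrt ((g x + g0 x) / 2) - sqrt (g0 x))\<^sup>2)"

lemma sqrt_diff_mult_sqrt_add:
  fixes u v :: real
  assumes "0 \<le> u" "0 \<le> v"
  shows "(sqrt u - sqrt v) * (sqrt u + sqrt v) = u - v"
  using assms by (simp add: algebra_simps)

text \<open>\<open>u - v\<close> is twice \<open>?m - v\<close>, which factors into the difference
  and the sum of the square roots; the squared sum is at most \<open>4 * b\<close>. Second moments
  thus turn into midpoint gaps at the price of one factor \<open>b\<close>, the sup bound of the
  ball.\<close>

lemma square_diff_le_midpoint:
  fixes u v :: real
  assumes "0 \<le> u" "0 \<le> v" "u \<le> b" "v \<le> b"
  shows "(u - v)\<^sup>2 \<le> 16 * b * (sqrt ((u + v) / 2) - sqrt v)\<^sup>2"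
proof -
  let ?m = "(u + v) / 2"
  have "(sqrt ?m + sqrt v)\<^sup>2 \<le> 2 * (sqrt ?m)\<^sup>2 + 2 * (sqrt v)\<^sup>2"
    using zero_le_power2[of "sqrt ?m - sqrt v"] by (simp add: power2_eq_square algebra_simps)
  also have "\<dots> = 2 * ?m + 2 * v" using assms by simp
  also have "\<dots> \<le> 4 * b" using assms by argo
  finally have S: "(sqrt ?m + sqrt v)\<^sup>2 \<le> 4 * b" .
  have "u - v = 2 * (?m - v)" by (simp add: field_simps)
  also have "?m - v = (sqrt ?m - sqrt v) * (sqrt ?m + sqrt v)"
    using assms by (intro sqrt_diff_mult_sqrt_add[symmetric]) auto
  finally have "(u - v)\<^sup>2 = 4 * (sqrt ?m - sqrt v)\<^sup>2 * (sqrt ?m + sqrt v)\<^sup>2"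
    by (simp add: power_mult_distrib)
  also have "\<dots> \<le> 4 * (sqrt ?m - sqrt v)\<^sup>2 * (4 * b)"
    using S by (intro mult_left_mono) auto
  finally show ?thesis by (simp add: algebra_simps)
qed

text \<open>This leads back from the midpoint to the function itself. Factor both sides of
  \<open>\<bar>u - v\<bar> = 2 * \<bar>?m - v\<bar>\<close> into square roots; as
  \<open>sqrt ?m + sqrt v\<close> is at most \<open>2 * (sqrt u + sqrt v)\<close>, the loss is a
  factor 4, squared 16.\<close>

lemma sqrt_diff_le_midpoint:
  fixes u v :: real
  assumes "0 \<le> u" "0 < v"
  shows "(sqrt v - sqrt u)\<^sup>2 \<le> 16 * (sqrt ((u + v) / 2) - sqrt v)\<^sup>2"
proof -
  let ?m = "(u + v) / 2"
  have pos: "0 < sqrt u + sqrt v" using assms by (simp add: add_nonneg_pos)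
  have "sqrt ?m \<le> sqrt u + sqrt v"
    using assms by (intro real_le_lsqrt) (auto simp: power2_sum)
  then have S: "sqrt ?m + sqrt v \<le> 2 * (sqrt u + sqrt v)"
    using real_sqrt_ge_zero[OF assms(1)] by argo
  have "\<bar>sqrt u - sqrt v\<bar> * (sqrt u + sqrt v) = \<bar>(sqrt u - sqrt v) * (sqrt u + sqrt v)\<bar>"
    using pos by (simp only: abs_mult abs_of_pos)
  also have "\<dots> = \<bar>u - v\<bar>" using sqrt_diff_mult_sqrt_add[of u v] assms by simp
  also have "\<dots> = 2 * \<bar>?m - v\<bar>" by (simp add: field_simps abs_if)
  also have "\<bar>?m - v\<bar> = \<bar>(sqrt ?m - sqrt v) * (sqrt ?m + sqrt v)\<bar>"
    using assms by (subst sqrt_diff_mult_sqrt_add) auto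
  also have "\<dots> = \<bar>sqrt ?m - sqrt v\<bar> * (sqrt ?m + sqrt v)"
    using assms by (simp add: abs_mult)
  also have "2 * (\<bar>sqrt ?m - sqrt v\<bar> * (sqrt ?m + sqrt v)) \<le> 2 * (\<bar>sqrt ?m - sqrt v\<bar> * (2 * (sqrt u + sqrt v)))"
    using S by (intro mult_left_mono) auto
  finally have "\<bar>sqrt u - sqrt v\<bar> * (sqrt u + sqrt v) \<le> 4 * \<bar>sqrt ?m - sqrt v\<bar> * (sqrt u + sqrt v)"
    by (simp add: algebra_simps)
  then have "\<bar>sqrt u - sqrt v\<bar> \<le> 4 * \<bar>sqrt ?m - sqrt v\<bar>" using pos by (simp only: mult_le_cancel_right_pos)
  then have "\<bar>sqrt u - sqrt v\<bar>\<^sup>2 \<le> (4 * \<bar>sqrt ?m - sqrt v\<bar>)\<^sup>2" by (intro power_mono) auto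
  then show ?thesis by (simp add: power_mult_distrib power2_commute)
qed

lemma midpoint_integrable:
  assumes "prob_space Q" "g \<in> bdd_measurable Q b" "g0 \<in> bdd_measurable Q b0"
    "\<And>x. x \<in> space Q \<Longrightarrow> 0 \<le> g x \<and> 0 \<le> g0 x"
  shows "integrable Q (\<lambda>x. (sqrt ((g x + g0 x) / 2) - sqrt (g0 x))\<^sup>2)"
proof (rule bdd_measurable_integrable[OF assms(1) bdd_measurableI[where b = "b + b0"]])
  note [measurable] = bdd_measurableD(1)[OF assms(2)] bdd_measurableD(1)[OF assms(3)]
  show "(\<lambda>x. (sqrt ((g x + g0 x) / 2) - sqrt (g0 x))\<^sup>2) \<in> borel_measurable Q" by measurable
  fix x assume x: "x \<in> space Q"
  let ?m = "(g x + g0 x) / 2"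
  have b: "0 \<le> g x" "0 \<le> g0 x" "g x \<le> b" "g0 x \<le> b0"
    using assms(4)[OF x] bdd_measurableD(2)[OF assms(2) x] bdd_measurableD(2)[OF assms(3) x] by auto
  show "\<bar>(sqrt ?m - sqrt (g0 x))\<^sup>2\<bar> \<le> b + b0"
  proof (cases "g0 x \<le> ?m")
    case True
    then have "(sqrt ?m - sqrt (g0 x))\<^sup>2 \<le> (sqrt ?m)\<^sup>2" using b by (intro power_mono) auto
    then show ?thesis using b by simp
  next
    case False
    then have "(sqrt (g0 x) - sqrt ?m)\<^sup>2 \<le> (sqrt (g0 x))\<^sup>2" using b by (intro power_mono) auto
    then show ?thesis using b by (simp add: power2_commute)
  qed
qed

text \<open>One statement for both samples: \<Phi> will be the log ratio of the midpoint under
  \<open>P\<close> and half the difference under \<open>Q\<close>. As \<Phi> is Lipschitz and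
  vanishes at \<open>g0\<close>, its second moment on ball \<open>j\<close> is at most a constant
  times \<open>2 ^ j\<close> times the midpoint gap, and \<open>2 ^ j\<close> cancels against the
  coefficient in \<open>dyadic_deviation\<close>.\<close>

lemma composed_deviation:
  fixes G :: "nat \<Rightarrow> ('a \<Rightarrow> real) set" and \<eta> \<Lambda> b A \<gamma> :: real
  assumes M: "prob_space M" "iid_sample M R Z" and Q: "prob_space Q" and R: "sets R = sets Q"
    and dom: "\<And>w. (\<And>x. x \<in> space Q \<Longrightarrow> 0 \<le> w x) \<Longrightarrow> integrable Q w \<Longrightarrow>
      integrable R w \<and> (LINT x|R. w x) \<le> \<eta> * (LINT x|Q. w x)"
    and meas: "\<And>g. g \<in> borel_measurable Q \<Longrightarrow> (\<lambda>x. \<Phi> x (g x)) \<in> borel_measurable Q"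
    and lip: "\<And>x u v. x \<in> space Q \<Longrightarrow> 0 \<le> u \<Longrightarrow> 0 \<le> v \<Longrightarrow> \<bar>\<Phi> x u - \<Phi> x v\<bar> \<le> \<Lambda> * \<bar>u - v\<bar>"
    and btw: "\<And>x u y v. x \<in> space Q \<Longrightarrow> 0 \<le> u \<Longrightarrow> u \<le> y \<Longrightarrow> y \<le> v \<Longrightarrow>
      min (\<Phi> x u) (\<Phi> x v) \<le> \<Phi> x y \<and> \<Phi> x y \<le> max (\<Phi> x u) (\<Phi> x v)"
    and \<Phi>0: "\<And>x. x \<in> space Q \<Longrightarrow> \<Phi> x (g0 x) = 0"
    and pos: "0 < \<eta>" "0 < \<Lambda>" "0 < b" and \<gamma>: "0 < \<gamma>" "\<gamma> < 2" and A: "0 \<le> A"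
    and g0: "g0 \<in> borel_measurable Q" "\<And>x. x \<in> space Q \<Longrightarrow> 0 \<le> g0 x \<and> g0 x \<le> b"
    and G: "\<And>j. G j \<subseteq> borel_measurable Q"
      "\<And>j g x. g \<in> G j \<Longrightarrow> x \<in> space Q \<Longrightarrow> 0 \<le> g x \<and> g x \<le> b * 2 ^ j"
    and entropy: "\<And>j \<delta>. 0 < \<delta> \<Longrightarrow> bracketing_entropy Q \<delta> (G j) \<le> ereal (A * (2 ^ j / \<delta>) powr \<gamma>)"
  shows "\<exists>T\<ge>0. \<forall>a\<ge>1. \<forall>n\<ge>1. \<exists>B\<in>sets M. measure M B \<le> 4 * exp (- a) \<and>
     (\<forall>\<omega>\<in>space M - B. \<forall>j. \<forall>g\<in>G j. deviation R n (\<lambda>i. Z i \<omega>) (\<lambda>x. \<Phi> x (g x)) \<le>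
        midpoint_gap Q g0 g / 4 + T * (a + j) * 2 ^ j * n powr (- 2 / (2 + \<gamma>)))"
proof -
  have sp: "space R = space Q" using R by (rule sets_eq_imp_space_eq)
  have meas_eq: "borel_measurable R = borel_measurable Q" using R by (intro measurable_cong_sets) auto
  define F where "F j = (\<lambda>g x. \<Phi> x (g x)) ` G j" for j
  define K where "K = \<Lambda> * b"
  define V where "V = \<eta> * \<Lambda>\<^sup>2 * (16 * b)"
  \<comment> \<open>Each summand of the denominator secures one condition:
    \<open>\<kappa> * K \<le> 1\<close> for the exponential bound, and
    \<open>2 * \<kappa> * V \<le> 1 / 4\<close> for the share of the gap.\<close>
  define \<kappa> where "\<kappa> = 1 / (K + 8 * V)"
  have K: "0 < K" and V: "0 < V" using pos by (auto simp: K_def V_def)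
  have \<kappa>: "0 < \<kappa>" "\<kappa> * K \<le> 1" "\<kappa> * V \<le> 1 / 8" using K V by (auto simp: \<kappa>_def field_simps)
  have bj: "b \<le> b * 2 ^ j" for j :: nat using pos by simp
  have \<Phi>lip: "\<bar>\<Phi> x (g x)\<bar> \<le> \<Lambda> * \<bar>g x - g0 x\<bar>" if "g \<in> G j" "x \<in> space Q" for g j x
    using lip[OF that(2), of "g x" "g0 x"] \<Phi>0[OF that(2)] G(2)[OF that] g0(2)[OF that(2)] by simp
  have \<Phi>bd: "\<bar>\<Phi> x (g x)\<bar> \<le> K * 2 ^ j" if g: "g \<in> G j" and x: "x \<in> space Q" for g j x
  proof -
    have "\<bar>g x - g0 x\<bar> \<le> b * 2 ^ j"
      using G(2)[OF g x] g0(2)[OF x] bj[of j] by (auto simp: abs_le_iff)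
    then show ?thesis
      using order_trans[OF \<Phi>lip[OF g x] mult_left_mono[OF _ less_imp_le[OF pos(2)]]]
      by (simp add: K_def mult.assoc)
  qed
  have FK: "F j \<subseteq> bdd_measurable R (K * 2 ^ j)" for j
    using G(1)[of j] \<Phi>bd unfolding F_def bdd_measurable_def sp meas_eq by (auto intro!: meas)
  have cover: "\<exists>N. real N \<le> exp (A * (sqrt \<eta> * \<Lambda>) powr \<gamma> * (2 ^ j / \<delta>) powr \<gamma>) \<and>
     bracket_cover R (K * 2 ^ j) \<delta> N (F j)" if \<delta>: "0 < \<delta>" for j \<delta>
  proof -
    \<comment> \<open>The transformation multiplies widths by
      \<open>sqrt \<eta> * \<Lambda>\<close>, so the original brackets are taken at a
      correspondingly rescaled width. The entropy constant changes by that factor to the power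
      \<gamma>.\<close>
    define \<delta>' where "\<delta>' = \<delta> / (sqrt \<eta> * \<Lambda>)"
    have \<delta>': "0 < \<delta>'" "sqrt \<eta> * \<Lambda> * \<delta>' = \<delta>" using \<delta> pos by (auto simp: \<delta>'_def)
    have "0 \<le> A * (2 ^ j / \<delta>') powr \<gamma>" using A by simp
    from entropy_brackets[OF entropy[OF \<delta>'(1), of j] this]
    obtain N L U where N: "real N \<le> exp (A * (2 ^ j / \<delta>') powr \<gamma>)"
      and br: "\<forall>i<N. L i \<in> borel_measurable Q \<and> U i \<in> borel_measurable Q \<and>
        integrable Q (\<lambda>x. (U i x - L i x)\<^sup>2) \<and> sqrt (LINT x|Q. (U i x - L i x)\<^sup>2) \<le> \<delta>'"
      and cov: "\<forall>g\<in>G j. \<exists>i<N. \<forall>x\<in>space Q. L i x \<le> g x \<and> g x \<le> U i x"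
      by blast
    have "bracket_cover R (K * 2 ^ j) (sqrt \<eta> * \<Lambda> * \<delta>') N ((\<lambda>g x. \<Phi> x (g x)) ` G j)"
    proof (rule bracket_cover_compose[where L = L and U = U, OF R])
      show "integrable R w \<and> (LINT x|R. w x) \<le> \<eta> * (LINT x|Q. w x)"
        if "\<And>x. x \<in> space Q \<Longrightarrow> 0 \<le> w x" "integrable Q w" for w
        using that by (rule dom)
      show "0 \<le> g x \<and> \<bar>\<Phi> x (g x)\<bar> \<le> K * 2 ^ j" if "g \<in> G j" "x \<in> space Q" for g x
        using G(2)[OF that] \<Phi>bd[OF that] by blast
      show "L i \<in> borel_measurable Q" "U i \<in> borel_measurable Q"
        "integrable Q (\<lambda>x. (U i x - L i x)\<^sup>2) \<and> sqrt (LINT x|Q. (U i x - L i x)\<^sup>2) \<le> \<delta>'"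
        if "i < N" for i
        using br that by blast+
      show "\<exists>i<N. \<forall>x\<in>space Q. L i x \<le> g x \<and> g x \<le> U i x" if "g \<in> G j" for g
        using cov that by blast
      show "0 \<le> \<eta>" "0 \<le> \<Lambda>" "0 \<le> K * 2 ^ j" "0 \<le> \<delta>'" using pos K \<delta>' by simp_all
    qed (fact meas lip btw)+
    moreover have "(2 ^ j / \<delta>') powr \<gamma> = (sqrt \<eta> * \<Lambda>) powr \<gamma> * (2 ^ j / \<delta>) powr \<gamma>"
    proof -
      have "2 ^ j / \<delta>' = (sqrt \<eta> * \<Lambda>) * (2 ^ j / \<delta>)" by (simp add: \<delta>'_def)
      then show ?thesis using pos \<delta> by (simp only: powr_mult)
    qed
    ultimately show ?thesis
      using N unfolding \<delta>'(2) unfolding F_def mult.assoc by (intro exI[of _ N]) simp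
  qed
  have "0 \<le> A * (sqrt \<eta> * \<Lambda>) powr \<gamma>" using A by simp
  then have "\<exists>T\<ge>0. \<forall>a\<ge>1. \<forall>n\<ge>1. \<exists>B\<in>sets M. measure M B \<le> 4 * exp (- a) \<and>
     (\<forall>\<omega>\<in>space M - B. \<forall>j. \<forall>f\<in>F j. deviation R n (\<lambda>i. Z i \<omega>) f \<le>
        2 * \<kappa> / 2 ^ j * (LINT x|R. (f x)\<^sup>2) + T * (a + j) * 2 ^ j * n powr (- 2 / (2 + \<gamma>)))"
    by (rule dyadic_deviation[OF M \<gamma> _ \<kappa>(1,2) FK]) (erule cover)
  then obtain T where T: "0 \<le> T" and dev: "\<forall>a\<ge>1. \<forall>n\<ge>1. \<exists>B\<in>sets M. measure M B \<le> 4 * exp (- a) \<and>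
     (\<forall>\<omega>\<in>space M - B. \<forall>j. \<forall>f\<in>F j. deviation R n (\<lambda>i. Z i \<omega>) f \<le>
        2 * \<kappa> / 2 ^ j * (LINT x|R. (f x)\<^sup>2) + T * (a + j) * 2 ^ j * n powr (- 2 / (2 + \<gamma>)))"
    by (elim exE conjE)
  have small: "2 * \<kappa> / 2 ^ j * (LINT x|R. (\<Phi> x (g x))\<^sup>2) \<le> midpoint_gap Q g0 g / 4" if g: "g \<in> G j" for j g
  proof -
    let ?w = "\<lambda>x. \<Lambda>\<^sup>2 * (16 * (b * 2 ^ j)) * (sqrt ((g x + g0 x) / 2) - sqrt (g0 x))\<^sup>2"
    have gb: "g \<in> bdd_measurable Q (b * 2 ^ j)" "g0 \<in> bdd_measurable Q b"
      using G g g0 by (auto intro!: bdd_measurableI)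
    have int: "integrable Q ?w"
      using midpoint_integrable[OF Q gb] G(2)[OF g] g0(2) by simp
    have nonneg: "0 \<le> ?w x" for x using pos by simp
    have "(LINT x|R. (\<Phi> x (g x))\<^sup>2) \<le> (LINT x|R. ?w x)"
    proof (rule integral_mono')
      show "integrable R ?w" using dom[OF nonneg int] by simp
      show "(\<Phi> x (g x))\<^sup>2 \<le> ?w x" if "x \<in> space R" for x
      proof -
        have x: "x \<in> space Q" using that sp by simp
        have "(\<Phi> x (g x))\<^sup>2 \<le> (\<Lambda> * \<bar>g x - g0 x\<bar>)\<^sup>2"
          using power_mono[OF \<Phi>lip[OF g x] abs_ge_zero, of 2] by simp
        also have "\<dots> = \<Lambda>\<^sup>2 * (g x - g0 x)\<^sup>2" by (simp add: power_mult_distrib)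
        also have "\<dots> \<le> \<Lambda>\<^sup>2 * (16 * (b * 2 ^ j) * (sqrt ((g x + g0 x) / 2) - sqrt (g0 x))\<^sup>2)"
          using G(2)[OF g x] g0(2)[OF x] bj[of j]
          by (intro mult_left_mono square_diff_le_midpoint) auto
        finally show ?thesis by (simp only: mult.assoc)
      qed
    qed (use nonneg in auto)
    also have "\<dots> \<le> \<eta> * (LINT x|Q. ?w x)" using dom[OF nonneg int] by simp
    also have "\<dots> = V * 2 ^ j * midpoint_gap Q g0 g" by (simp add: midpoint_gap_def V_def)
    finally have "2 * \<kappa> / 2 ^ j * (LINT x|R. (\<Phi> x (g x))\<^sup>2) \<le> 2 * \<kappa> / 2 ^ j * (V * 2 ^ j * midpoint_gap Q g0 g)"
      using \<kappa> by (intro mult_left_mono) auto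
    also have "\<dots> = 2 * (\<kappa> * V) * midpoint_gap Q g0 g" by simp
    also have "\<dots> \<le> 2 * (1 / 8) * midpoint_gap Q g0 g"
      using \<kappa>(3) by (intro mult_right_mono mult_left_mono) (auto simp: midpoint_gap_def)
    finally show ?thesis by simp
  qed
  show ?thesis
  proof (rule exI[of _ T], intro conjI allI impI)
    fix a :: real and n :: nat
    assume an: "1 \<le> a" "1 \<le> n"
    from dev[rule_format, OF an]
    obtain B where B: "B \<in> sets M" "measure M B \<le> 4 * exp (- a)"
      and d: "\<forall>\<omega>\<in>space M - B. \<forall>j. \<forall>f\<in>F j. deviation R n (\<lambda>i. Z i \<omega>) f \<le>
        2 * \<kappa> / 2 ^ j * (LINT x|R. (f x)\<^sup>2) + T * (a + j) * 2 ^ j * n powr (- 2 / (2 + \<gamma>))"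
      by (elim bexE conjE)
    have "deviation R n (\<lambda>i. Z i \<omega>) (\<lambda>x. \<Phi> x (g x)) \<le>
        midpoint_gap Q g0 g / 4 + T * (a + j) * 2 ^ j * n powr (- 2 / (2 + \<gamma>))"
      if \<omega>: "\<omega> \<in> space M - B" and g: "g \<in> G j" for \<omega> j g
    proof -
      have "(\<lambda>x. \<Phi> x (g x)) \<in> F j" using g unfolding F_def by (rule imageI)
      from d[rule_format, OF \<omega> this] small[OF g] show ?thesis by argo
    qed
    then show "\<exists>B\<in>sets M. measure M B \<le> 4 * exp (- a) \<and>
        (\<forall>\<omega>\<in>space M - B. \<forall>j. \<forall>g\<in>G j. deviation R n (\<lambda>i. Z i \<omega>) (\<lambda>x. \<Phi> x (g x)) \<le>
          midpoint_gap Q g0 g / 4 + T * (a + j) * 2 ^ j * n powr (- 2 / (2 + \<gamma>)))"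
      using B by (intro bexI[of _ B]) auto
  qed (rule T)
qed

section \<open>Comparison of the minimiser with the likelihood ratio\<close>

text \<open>Apply \<open>ln t \<le> 2 * (sqrt t - 1)\<close> at \<open>t = ?m / v\<close>. This is
  the pointwise form of the classical bound of a squared Hellinger distance by a Kullback-Leibler
  divergence; the term \<open>(u - v) / 2\<close> corrects for the midpoint not having mass
  1.\<close>

lemma midpoint_kl_pointwise:
  fixes u v :: real
  assumes "0 \<le> u" "0 < v"
  shows "(sqrt ((u + v) / 2) - sqrt v)\<^sup>2 \<le> (u - v) / 2 - v * ln ((u + v) / (2 * v))"
proof -
  let ?m = "(u + v) / 2"
  have m: "0 < ?m" using assms by simp
  have "ln (?m / v) = 2 * ln (sqrt (?m / v))" using m assms by (simp add: ln_sqrt)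
  also have "\<dots> \<le> 2 * (sqrt (?m / v) - 1)"
    using m assms by (intro mult_left_mono ln_le_minus_one) auto
  finally have "v * ln (?m / v) \<le> v * (2 * (sqrt (?m / v) - 1))"
    using assms by (intro mult_left_mono) auto
  also have "\<dots> = 2 * (v * sqrt (?m / v)) - 2 * v" by (simp add: algebra_simps)
  also have "v * sqrt (?m / v) = sqrt ?m * sqrt v"
  proof -
    have "v * sqrt (?m / v) = (sqrt v * sqrt v) * (sqrt ?m / sqrt v)"
      using assms by (simp only: real_sqrt_divide real_sqrt_mult_self abs_of_pos)
    also have "\<dots> = sqrt ?m * sqrt v" using assms by (simp del: real_sqrt_mult_self)
    finally show ?thesis .
  qed
  finally have "v * ln (?m / v) \<le> 2 * (sqrt ?m * sqrt v) - 2 * v" .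
  moreover have "(sqrt ?m - sqrt v)\<^sup>2 = ?m + v - 2 * (sqrt ?m * sqrt v)"
    using m assms by (simp add: power2_diff)
  moreover have "(u + v) / (2 * v) = ?m / v" by simp
  moreover have "(u - v) / 2 = ?m - v" by (simp add: field_simps)
  ultimately show ?thesis by argo
qed

text \<open>The inequality of arithmetic and geometric means
  \<open>u * v \<le> ((u + v) / 2)^2\<close>, divided by \<open>v^2\<close>, under the
  logarithm.\<close>

lemma ln_midpoint_concave:
  fixes u v :: real
  assumes "0 < u" "0 < v"
  shows "ln u - ln v \<le> 2 * ln ((u + v) / (2 * v))"
proof -
  have "u / v \<le> ((u + v) / (2 * v))\<^sup>2"
    using assms zero_le_power2[of "u - v"] by (simp add: field_simps power2_eq_square)
  then have "ln (u / v) \<le> ln (((u + v) / (2 * v))\<^sup>2)"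
    using assms by (subst ln_le_cancel_iff) auto
  then show ?thesis using assms by (simp add: ln_div ln_realpow add_pos_pos)
qed

text \<open>Adding \<open>v \<ge> e\<close> keeps the logarithm away from its singularity, so the
  slope stays below \<open>1 / e\<close> even where \<open>u\<close> or \<open>w\<close>
  vanishes.\<close>

lemma ln_midpoint_lipschitz:
  fixes u w v e :: real
  assumes "0 \<le> u" "0 \<le> w" "0 < e" "e \<le> v"
  shows "\<bar>ln ((u + v) / (2 * v)) - ln ((w + v) / (2 * v))\<bar> \<le> 1 / e * \<bar>u - w\<bar>"
proof -
  have *: "ln ((u + v) / (2 * v)) - ln ((w + v) / (2 * v)) \<le> 1 / e * \<bar>u - w\<bar>"
    if "0 \<le> u" "0 \<le> w" for u w
  proof -
    have p: "0 < u + v" "0 < w + v" "0 < v" using that assms by auto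
    have "ln ((u + v) / (2 * v)) - ln ((w + v) / (2 * v)) = ln ((u + v) / (w + v))"
      using p by (simp add: ln_div)
    also have "\<dots> \<le> (u + v) / (w + v) - 1" using p by (intro ln_le_minus_one) auto
    also have "\<dots> = (u - w) / (w + v)" using p by (simp add: field_simps)
    also have "\<dots> \<le> \<bar>u - w\<bar> / (w + v)" using p by (intro divide_right_mono) auto
    also have "\<dots> \<le> \<bar>u - w\<bar> / e" using that assms by (intro divide_left_mono) auto
    finally show ?thesis by simp
  qed
  show ?thesis using *[of u w] *[of w u] assms by (simp add: abs_le_iff abs_minus_commute)
qed

lemma density_dominated:
  assumes P: "P = density Q (\<lambda>x. ennreal (g0 x))"
    and g0: "g0 \<in> borel_measurable Q" "\<And>x. x \<in> space Q \<Longrightarrow> 0 \<le> g0 x \<and> g0 x \<le> \<eta>"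
    and w: "\<And>x. x \<in> space Q \<Longrightarrow> 0 \<le> w x" "integrable Q w"
  shows "integrable P w \<and> (LINT x|P. w x) \<le> \<eta> * (LINT x|Q. w x)"
proof -
  have nn: "AE x in Q. 0 \<le> g0 x" using g0 by (intro AE_I2) auto
  have wm: "w \<in> borel_measurable Q" using w(2) by simp
  have int: "integrable Q (\<lambda>x. g0 x * w x)"
  proof (rule Bochner_Integration.integrable_bound[where f = "\<lambda>x. \<eta> * w x"])
    show "AE x in Q. norm (g0 x * w x) \<le> norm (\<eta> * w x)"
    proof (rule AE_I2)
      fix x assume x: "x \<in> space Q"
      have "\<bar>g0 x\<bar> \<le> \<bar>\<eta>\<bar>" using g0(2)[OF x] by auto
      then show "norm (g0 x * w x) \<le> norm (\<eta> * w x)"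
        by (simp add: abs_mult mult_right_mono)
    qed
  qed (use w g0 wm in auto)
  have "(LINT x|P. w x) = (LINT x|Q. g0 x * w x)"
    unfolding P using integral_density[OF wm g0(1) nn] by simp
  also have "\<dots> \<le> (LINT x|Q. \<eta> * w x)"
    using int w g0(2) by (intro integral_mono) (auto intro!: mult_right_mono)
  finally show ?thesis
    using int integrable_density[OF wm g0(1) nn] unfolding P by simp
qed

text \<open>Integrate \<open>midpoint_kl_pointwise\<close> under \<open>Q\<close>; the factor
  \<open>g0\<close> turns the logarithmic part into an integral under \<open>P\<close>. The two
  integrals on the right are the centrings of the deviations in \<open>log_ratio_gain_le\<close>,
  where they supply the negative gap.\<close>

lemma midpoint_gap_le:
  assumes Q: "prob_space Q" and P: "P = density Q (\<lambda>x. ennreal (g0 x))"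
    and e: "0 < e" and g0: "g0 \<in> borel_measurable Q" "\<And>x. x \<in> space Q \<Longrightarrow> e \<le> g0 x \<and> g0 x \<le> \<eta>"
    and g: "g \<in> borel_measurable Q" "\<And>x. x \<in> space Q \<Longrightarrow> 0 \<le> g x \<and> g x \<le> b"
  shows "midpoint_gap Q g0 g \<le> - (LINT x|Q. (g0 x - g x) / 2) - (LINT x|P. ln ((g x + g0 x) / (2 * g0 x)))"
proof -
  let ?f = "\<lambda>x. ln ((g x + g0 x) / (2 * g0 x))"
  note [measurable] = g0(1) g(1)
  have bd: "g \<in> bdd_measurable Q b" "g0 \<in> bdd_measurable Q \<eta>"
    using g g0 e by (force intro!: bdd_measurableI)+
  have ig: "integrable Q g" "integrable Q g0" using bd bdd_measurable_integrable[OF Q] by auto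
  have nn: "AE x in Q. 0 \<le> g0 x" using g0(2) e by (intro AE_I2) force
  have igap: "integrable Q (\<lambda>x. (sqrt ((g x + g0 x) / 2) - sqrt (g0 x))\<^sup>2)"
    by (rule midpoint_integrable[OF Q bd]) (use g g0 e in force)
  have fm: "?f \<in> borel_measurable Q" by measurable
  have "(\<lambda>x. g0 x * ?f x) \<in> bdd_measurable Q (\<eta> * (1 / e * (b + \<eta>)))"
  proof (rule bdd_measurableI)
    fix x assume x: "x \<in> space Q"
    have "\<bar>?f x\<bar> \<le> 1 / e * \<bar>g x - g0 x\<bar>"
      using ln_midpoint_lipschitz[of "g x" "g0 x" e "g0 x"] g(2)[OF x] g0(2)[OF x] e by simp
    also have "\<dots> \<le> 1 / e * (b + \<eta>)"
      using g(2)[OF x] g0(2)[OF x] e by (intro mult_left_mono) auto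
    finally show "\<bar>g0 x * ?f x\<bar> \<le> \<eta> * (1 / e * (b + \<eta>))"
      unfolding abs_mult using g0(2)[OF x] e by (intro mult_mono) auto
  qed measurable
  then have igf: "integrable Q (\<lambda>x. g0 x * ?f x)" by (rule bdd_measurable_integrable[OF Q])
  have "midpoint_gap Q g0 g \<le> (LINT x|Q. (g x - g0 x) / 2 - g0 x * ?f x)"
    unfolding midpoint_gap_def
  proof (rule integral_mono[OF igap])
    fix x assume x: "x \<in> space Q"
    show "(sqrt ((g x + g0 x) / 2) - sqrt (g0 x))\<^sup>2 \<le> (g x - g0 x) / 2 - g0 x * ?f x"
      by (rule midpoint_kl_pointwise) (use g(2)[OF x] g0(2)[OF x] e in auto)
  qed (use ig igf in auto)
  also have "\<dots> = (LINT x|Q. (g x - g0 x) / 2) - (LINT x|Q. g0 x * ?f x)"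
    using ig igf by (intro Bochner_Integration.integral_diff) auto
  also have "(LINT x|Q. (g x - g0 x) / 2) = - (LINT x|Q. (g0 x - g x) / 2)"
    using ig by (simp add: field_simps)
  also have "(LINT x|Q. g0 x * ?f x) = (LINT x|P. ?f x)"
    unfolding P using integral_density[OF fm g0(1) nn] by simp
  finally show ?thesis .
qed

text \<open>The unpenalised empirical risk of \<open>g0\<close> minus that of
  \<open>g\<close>.\<close>

definition log_ratio_gain :: "nat \<Rightarrow> (nat \<Rightarrow> 'a) \<Rightarrow> (nat \<Rightarrow> 'a) \<Rightarrow> ('a \<Rightarrow> real) \<Rightarrow> ('a \<Rightarrow> real) \<Rightarrow> real" where
  "log_ratio_gain n x y g0 g =
     (\<Sum>i<n. ln (g (x i)) - ln (g0 (x i))) / real n - (\<Sum>i<n. g (y i) - g0 (y i)) / real n"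

text \<open>By concavity of the logarithm, \<open>g\<close> may be replaced by its midpoint with \<open>g0\<close>, for which the
  log ratio is bounded below.\<close>

lemma log_ratio_gain_le:
  assumes Q: "prob_space Q" and P: "P = density Q (\<lambda>x. ennreal (g0 x))"
    and e: "0 < e" and g0: "g0 \<in> borel_measurable Q" "\<And>x. x \<in> space Q \<Longrightarrow> e \<le> g0 x \<and> g0 x \<le> \<eta>"
    and g: "g \<in> borel_measurable Q" "\<And>x. x \<in> space Q \<Longrightarrow> 0 \<le> g x \<and> g x \<le> b"
    and x: "\<And>i. x i \<in> space Q" "\<And>i. i < n \<Longrightarrow> 0 < g (x i)"
  shows "log_ratio_gain n x y g0 g \<le>
     2 * (deviation P n x (\<lambda>z. ln ((g z + g0 z) / (2 * g0 z))) + deviation Q n y (\<lambda>z. (g0 z - g z) / 2))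
      - 2 * midpoint_gap Q g0 g"
proof -
  let ?f = "\<lambda>z. ln ((g z + g0 z) / (2 * g0 z))" and ?h = "\<lambda>z. (g0 z - g z) / 2"
  have "(\<Sum>i<n. ln (g (x i)) - ln (g0 (x i))) \<le> (\<Sum>i<n. 2 * ?f (x i))"
    using x(2) less_le_trans[OF e conjunct1[OF g0(2)[OF x(1)]]] by (intro sum_mono ln_midpoint_concave) auto
  then have "(\<Sum>i<n. ln (g (x i)) - ln (g0 (x i))) / n \<le> 2 * ((\<Sum>i<n. ?f (x i)) / n)"
    by (simp add: divide_right_mono flip: sum_distrib_left)
  moreover have "(\<Sum>i<n. g (y i) - g0 (y i)) / n = - 2 * ((\<Sum>i<n. ?h (y i)) / n)"
    by (simp add: sum_subtractf diff_divide_distrib flip: sum_divide_distrib)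
  moreover have "midpoint_gap Q g0 g \<le> - (LINT x|Q. ?h x) - (LINT x|P. ?f x)"
    by (rule midpoint_gap_le[OF Q P e g0 g])
  ultimately show ?thesis unfolding log_ratio_gain_def deviation_def by argo
qed

text \<open>The other summands have to avoid \<infinity>, because
  \<open>\<infinity> + -\<infinity>\<close> evaluates to \<infinity> in
  \<open>ereal\<close>.\<close>

lemma sum_ereal_eq_MInfty:
  fixes f :: "'b \<Rightarrow> ereal"
  assumes "finite I" "i \<in> I" "f i = -\<infinity>" "\<And>j. j \<in> I \<Longrightarrow> f j \<noteq> \<infinity>"
  shows "sum f I = -\<infinity>"
proof -
  have "sum f I = f i + sum f (I - {i})" using assms by (intro sum.remove) auto
  moreover have "sum f (I - {i}) \<noteq> \<infinity>" using assms(4) by (auto simp: sum_Pinfty)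
  ultimately show ?thesis using assms(3) by simp
qed

text \<open>\<open>g0\<close> has finite risk, hence so has the minimiser. Infinite complexity or a
  nonpositive value at some \<open>x i\<close> would make that risk \<infinity>, so both are
  excluded, and the comparison of the two risks becomes an inequality between real numbers.\<close>

lemma penalized_minimizer:
  assumes min: "is_arg_min (penalized_risk J l n x y) (\<lambda>g. g \<in> complexity_class D J) g"
    and n: "0 < n" and l: "0 < l" and J: "\<forall>g\<in>D. 0 \<le> J g"
    and g0: "g0 \<in> D" "J g0 < \<infinity>" "\<And>i. i < n \<Longrightarrow> 0 < g0 (x i)"
  shows "g \<in> D" "J g < \<infinity>" "\<And>i. i < n \<Longrightarrow> 0 < g (x i)"
    "l / 2 * ((real_of_ereal (J g))\<^sup>2 - (real_of_ereal (J g0))\<^sup>2) \<le> log_ratio_gain n x y g0 g"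
proof -
  have cc: "complexity_class D J = D"
  proof
    show "complexity_class D J \<subseteq> D" unfolding complexity_class_def complexity_ball_def by blast
    show "D \<subseteq> complexity_class D J"
    proof
      fix h assume "h \<in> D"
      then show "h \<in> complexity_class D J"
        unfolding complexity_class_def complexity_ball_def by (intro UN_I[of "\<infinity>"]) auto
    qed
  qed
  have gD: "g \<in> D" and le: "penalized_risk J l n x y g \<le> penalized_risk J l n x y g0"
    using min g0(1) unfolding is_arg_min_def cc by (auto simp: not_less)
  show "g \<in> D" by (rule gD)
  have "0 \<le> J g0" using J g0(1) by blast
  then obtain I0 where I0: "J g0 = ereal I0" "0 \<le> I0" using g0(2) by (cases "J g0") auto
  have "(\<Sum>i<n. ext_ln (g0 (x i))) = ereal (\<Sum>i<n. ln (g0 (x i)))"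
  proof -
    have "(\<Sum>i<n. ext_ln (g0 (x i))) = (\<Sum>i<n. ereal (ln (g0 (x i))))"
      by (rule sum.cong[OF refl]) (use g0(3) in \<open>simp add: ext_ln_def not_le[symmetric]\<close>)
    then show ?thesis by simp
  qed
  then have r0: "penalized_risk J l n x y g0 =
      ereal ((\<Sum>i<n. g0 (y i)) / n - (\<Sum>i<n. ln (g0 (x i))) / n + l / 2 * I0\<^sup>2)"
    using n by (simp add: penalized_risk_def I0)
  have "penalized_risk J l n x y g0 < \<infinity>" unfolding r0 by simp
  with le have fin: "penalized_risk J l n x y g < \<infinity>" by (rule le_less_trans)
  have J0: "0 \<le> J g" using J gD by blast
  show Jg: "J g < \<infinity>"
  proof (rule ccontr)
    assume "\<not> J g < \<infinity>"
    then have "J g = \<infinity>" by simp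
    then have "penalized_risk J l n x y g = \<infinity>" using l by (simp add: penalized_risk_def)
    then show False using fin by simp
  qed
  obtain I where I: "J g = ereal I" using J0 Jg by (cases "J g") auto
  show pos: "0 < g (x i)" if i: "i < n" for i
  proof (rule ccontr)
    assume "\<not> 0 < g (x i)"
    then have "(\<Sum>i<n. ext_ln (g (x i))) = -\<infinity>"
      using i by (intro sum_ereal_eq_MInfty[of _ i]) (auto simp: ext_ln_def)
    then have "penalized_risk J l n x y g = \<infinity>" using n I by (simp add: penalized_risk_def)
    then show False using fin by simp
  qed
  have "(\<Sum>i<n. ext_ln (g (x i))) = ereal (\<Sum>i<n. ln (g (x i)))"
  proof -
    have "(\<Sum>i<n. ext_ln (g (x i))) = (\<Sum>i<n. ereal (ln (g (x i))))"
      by (rule sum.cong[OF refl]) (use pos in \<open>simp add: ext_ln_def not_le[symmetric]\<close>)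
    then show ?thesis by simp
  qed
  then have "penalized_risk J l n x y g =
      ereal ((\<Sum>i<n. g (y i)) / n - (\<Sum>i<n. ln (g (x i))) / n + l / 2 * I\<^sup>2)"
    using n by (simp add: penalized_risk_def I)
  then have "(\<Sum>i<n. g (y i)) / n - (\<Sum>i<n. ln (g (x i))) / n + l / 2 * I\<^sup>2 \<le>
      (\<Sum>i<n. g0 (y i)) / n - (\<Sum>i<n. ln (g0 (x i))) / n + l / 2 * I0\<^sup>2"
    using le r0 by simp
  then show "l / 2 * ((real_of_ereal (J g))\<^sup>2 - (real_of_ereal (J g0))\<^sup>2) \<le> log_ratio_gain n x y g0 g"
    unfolding log_ratio_gain_def I I0 real_of_ereal.simps sum_subtractf diff_divide_distrib right_diff_distrib
    by linarith
qed

section \<open>Absorbing deviations into the penalty\<close>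

text \<open>The least admissible exponent works: its predecessor fails, which bounds the radius by a
  multiple of \<open>1 + I\<close>. Bounds in terms of the radius can then be charged to a penalty
  in \<open>I\<close>.\<close>

lemma dyadic_radius:
  fixes I :: real
  assumes "0 \<le> I"
  shows "\<exists>j::nat. I \<le> 2 ^ j \<and> 2 ^ j \<le> 2 * (1 + I)"
proof -
  define j where "j = (LEAST j. I \<le> 2 ^ j)"
  obtain m where "I < 2 ^ m" using real_arch_pow[of 2 I] by auto
  then have j: "I \<le> 2 ^ j" unfolding j_def by (intro LeastI[of "\<lambda>j. I \<le> 2 ^ j" m] less_imp_le)
  have "2 ^ j \<le> 2 * (1 + I)"
  proof (cases j)
    case (Suc i)
    then have "\<not> I \<le> 2 ^ i" unfolding j_def using not_less_Least[of i "\<lambda>j. I \<le> 2 ^ j"] by simp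
    then show ?thesis using Suc by simp
  qed (use assms in simp)
  then show ?thesis using j by blast
qed

lemma linear_times_dyadic_bound:
  fixes a e :: real
  assumes "0 < e"
  shows "\<exists>C\<ge>0. \<forall>j::nat. (a + j) * 2 ^ j \<le> e * (2 ^ j)\<^sup>2 + C"
proof -
  have "(\<lambda>j::nat. (a + real j) / 2 ^ j) \<longlonglongrightarrow> 0" by real_asymp
  then have "\<forall>\<^sub>F j in sequentially. (a + real j) / 2 ^ j < e"
    using assms by (rule order_tendstoD)
  then obtain m where m: "\<And>j. m \<le> j \<Longrightarrow> (a + real j) / 2 ^ j < e"
    by (auto simp: eventually_sequentially)
  \<comment> \<open>Only finitely many \<open>j\<close> precede the asymptotic regime;
    \<open>C\<close> adds up their values, with absolute values because \<open>a\<close> may be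
    negative.\<close>
  define C where "C = (\<Sum>j<m. \<bar>(a + real j) * 2 ^ j\<bar>)"
  have "(a + j) * 2 ^ j \<le> e * (2 ^ j)\<^sup>2 + C" for j :: nat
  proof (cases "m \<le> j")
    case True
    then have "(a + j) \<le> e * 2 ^ j" using m[of j] by (simp add: field_simps)
    then have "(a + j) * 2 ^ j \<le> e * 2 ^ j * 2 ^ j" by (intro mult_right_mono) auto
    moreover have "0 \<le> C" unfolding C_def by (intro sum_nonneg) auto
    ultimately show ?thesis unfolding power2_eq_square mult.assoc[symmetric] by linarith
  next
    case False
    then have "\<bar>(a + real j) * 2 ^ j\<bar> \<le> C"
      unfolding C_def by (intro member_le_sum) auto
    moreover have "0 \<le> e * (2 ^ j)\<^sup>2" using assms by simp
    ultimately show ?thesis by linarith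
  qed
  moreover have "0 \<le> C" unfolding C_def by (intro sum_nonneg) auto
  ultimately show ?thesis by blast
qed

text \<open>\<open>e\<close> is so small that the part of the deviation quadratic in
  \<open>I\<close> is at most \<open>l * I^2 / 4\<close>, half of the penalty in \<open>low\<close>.
  The other half survives, so \<open>gap\<close> is of order \<open>l\<close> and \<open>I^2\<close>
  is at most \<open>4 * K\<close>. Putting the latter back into \<open>up\<close> bounds
  \<open>\<Delta>\<close> in terms of \<open>d\<close> instead of \<open>l\<close>.\<close>

lemma penalty_absorbs:
  fixes gap l I I0 d c T C e \<Delta> a :: real and j :: nat
  assumes "0 \<le> gap" "0 < l" "0 \<le> I" "2 ^ j \<le> 2 * (1 + I)" "(a + j) * 2 ^ j \<le> e * (2 ^ j)\<^sup>2 + C"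
    and "0 \<le> d" "d \<le> c * l" "0 < c" "0 \<le> T" "0 \<le> C" and e: "e = 1 / (64 * (T + 1) * c)"
    and up: "\<Delta> \<le> - gap + 2 * (T * (a + j) * 2 ^ j * d)" and low: "l / 2 * (I\<^sup>2 - I0\<^sup>2) \<le> \<Delta>"
    and K: "K = I0\<^sup>2 / 2 + 2 * T * (8 * e + C) * c"
  shows "gap \<le> K * l" "\<Delta> \<le> 2 * T * (8 * e + C + 32 * e * K) * d" "- (K * l) \<le> \<Delta>"
proof -
  have e0: "0 < e" using assms by simp
  have "(2 ^ j)\<^sup>2 \<le> (2 * (1 + I))\<^sup>2" using assms by (intro power_mono) auto
  also have "\<dots> \<le> 8 + 8 * I\<^sup>2"
    using zero_le_power2[of "1 - I"] by (simp add: power2_eq_square algebra_simps)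
  finally have "(a + j) * 2 ^ j \<le> e * (8 + 8 * I\<^sup>2) + C"
    using assms(5) mult_left_mono[of "(2 ^ j)\<^sup>2" "8 + 8 * I\<^sup>2" e] e0 by linarith
  then have "2 * T * d * ((a + j) * 2 ^ j) \<le> 2 * T * d * (e * (8 + 8 * I\<^sup>2) + C)"
    using assms by (intro mult_left_mono) auto
  then have up': "\<Delta> \<le> - gap + 2 * T * (8 * e + C) * d + 16 * T * e * I\<^sup>2 * d"
    using up by (simp add: algebra_simps)
  have "16 * T * e * c \<le> 1 / 4"
  proof -
    have ec: "e * c = 1 / (64 * (T + 1))" using assms(8) unfolding e by simp
    have "16 * T * (e * c) = 1 / 4 * (T / (T + 1))" unfolding ec using assms(9) by (simp add: field_simps)
    then have "16 * T * e * c = 1 / 4 * (T / (T + 1))" by (simp only: mult.assoc)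
    also have "\<dots> \<le> 1 / 4" using assms(9) by simp
    finally show ?thesis .
  qed
  then have "16 * T * e * c * (I\<^sup>2 * l) \<le> 1 / 4 * (I\<^sup>2 * l)"
    using assms by (intro mult_right_mono) auto
  moreover have "16 * T * e * I\<^sup>2 * d \<le> 16 * T * e * I\<^sup>2 * (c * l)"
    using assms e0 by (intro mult_left_mono) auto
  ultimately have q: "16 * T * e * I\<^sup>2 * d \<le> 1 / 4 * (I\<^sup>2 * l)" by (simp add: algebra_simps)
  have "2 * T * (8 * e + C) * d \<le> 2 * T * (8 * e + C) * (c * l)"
    using assms e0 by (intro mult_left_mono) auto
  then have main: "gap + 1 / 4 * (I\<^sup>2 * l) \<le> K * l"
    using up' q low unfolding K by (simp add: algebra_simps)
  then show "gap \<le> K * l" using mult_nonneg_nonneg[OF zero_le_power2[of I] less_imp_le[OF assms(2)]] by argo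
  have "1 / 4 * I\<^sup>2 * l \<le> K * l" using main assms(1) by linarith
  then have IK: "I\<^sup>2 \<le> 4 * K" using assms(2) by simp
  have "16 * T * e * I\<^sup>2 * d \<le> 16 * T * e * (4 * K) * d"
    using assms e0 IK by (intro mult_right_mono mult_left_mono) auto
  then show "\<Delta> \<le> 2 * T * (8 * e + C + 32 * e * K) * d"
    using up' assms(1) by (simp add: algebra_simps)
  have "I0\<^sup>2 / 2 \<le> K" unfolding K using assms e0 by simp
  then have "I0\<^sup>2 / 2 * l \<le> K * l" using assms(2) by (intro mult_right_mono) auto
  moreover have "0 \<le> l / 2 * I\<^sup>2" using assms(2) by simp
  ultimately show "- (K * l) \<le> \<Delta>" using low by (simp add: algebra_simps)
qed

section \<open>Fluctuations of a single mean\<close>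

lemma deviation_root_n:
  assumes M: "prob_space M" "iid_sample M R Z" and f: "f \<in> bdd_measurable R b" and \<epsilon>: "0 < \<epsilon>"
  shows "\<exists>C\<ge>0. \<forall>n\<ge>1. \<exists>B\<in>sets M. measure M B \<le> \<epsilon> \<and>
     (\<forall>\<omega>\<in>space M - B. \<bar>deviation R n (\<lambda>i. Z i \<omega>) f\<bar> \<le> C * real n powr (- 1 / 2))"
proof -
  interpret prob_space M by fact
  note Z = iid_sampleD[OF M]
  interpret R: prob_space R by (rule Z(3))
  note [measurable] = Z(1) and fm [measurable] = bdd_measurableD(1)[OF f]
  \<comment> \<open>Adding 1 keeps the division by \<open>b'\<close> meaningful when
    \<open>b = 0\<close>.\<close>
  define b' where "b' = \<bar>b\<bar> + 1"
  define t where "t = \<bar>ln (\<epsilon> / 2)\<bar>"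
  have b': "0 < b'" and t: "0 \<le> t" by (auto simp: b'_def t_def)
  have fb: "\<bar>f x\<bar> \<le> b'" if "x \<in> space R" for x
    using bdd_measurableD(2)[OF f that] by (simp add: b'_def)
  have et: "exp (- t) \<le> \<epsilon> / 2"
  proof -
    have "exp (- t) \<le> exp (ln (\<epsilon> / 2))" by (simp add: t_def)
    then show ?thesis using \<epsilon> by simp
  qed
  have bound: "\<exists>B\<in>sets M. measure M B \<le> \<epsilon> / 2 \<and>
     (\<forall>\<omega>\<in>space M - B. deviation R n (\<lambda>i. Z i \<omega>) h \<le> b' * (1 + t) * real n powr (- 1 / 2))"
    if hm [measurable]: "h \<in> borel_measurable R" and hb: "\<And>x. x \<in> space R \<Longrightarrow> \<bar>h x\<bar> \<le> b'" and n: "1 \<le> n"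
    for h and n :: nat
  proof -
    \<comment> \<open>This choice keeps \<open>s * h\<close> at most 1 and makes the variance term
      and the tail term both of order \<open>1 / sqrt n\<close>.\<close>
    define s where "s = 1 / (b' * sqrt n)"
    have s: "0 < s" using b' n by (simp add: s_def)
    have h: "h \<in> bdd_measurable R b'" using hm hb by (rule bdd_measurableI)
    define B where "B = {\<omega>\<in>space M. s * (LINT x|R. (h x)\<^sup>2) + t / (n * s) \<le> deviation R n (\<lambda>i. Z i \<omega>) h}"
    have "measure M B \<le> exp (- t)" unfolding B_def
    proof (rule chernoff_iid[OF M h s])
      fix x assume "x \<in> space R"
      then have "s * h x \<le> s * b'" using hb[of x] s by (intro mult_left_mono) auto
      also have "\<dots> \<le> 1" using b' n by (simp add: s_def)
      finally show "s * h x \<le> 1" .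
    qed (use n in simp)
    then have "measure M B \<le> \<epsilon> / 2" using et by (rule order_trans)
    moreover have "B \<in> sets M" unfolding B_def deviation_def by measurable
    moreover have "deviation R n (\<lambda>i. Z i \<omega>) h \<le> b' * (1 + t) * real n powr (- 1 / 2)"
      if "\<omega> \<in> space M - B" for \<omega>
    proof -
      have "(LINT x|R. (h x)\<^sup>2) \<le> (LINT x|R. b'\<^sup>2)"
        using bdd_measurable_integrable[OF Z(3) bdd_measurable_square[OF h]]
        using power_mono[OF hb abs_ge_zero, of _ 2] by (intro integral_mono) simp_all
      then have "s * (LINT x|R. (h x)\<^sup>2) \<le> s * b'\<^sup>2" using s by (simp add: R.prob_space)
      also have "\<dots> = b' * (1 / sqrt n)" using b' by (simp add: s_def power2_eq_square)
      finally have 1: "s * (LINT x|R. (h x)\<^sup>2) \<le> b' * (1 / sqrt n)" .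
      have "t / (n * s) = b' * t * (sqrt n / n)" by (simp add: s_def)
      also have "sqrt n / n = 1 / sqrt n"
      proof -
        have "sqrt n / (sqrt n * sqrt n) = 1 / sqrt n" using n by (simp del: real_sqrt_mult_self)
        then show ?thesis by simp
      qed
      finally have 2: "t / (n * s) = b' * t * (1 / sqrt n)" .
      have "deviation R n (\<lambda>i. Z i \<omega>) h \<le> s * (LINT x|R. (h x)\<^sup>2) + t / (n * s)" using that unfolding B_def by auto
      also have "\<dots> \<le> b' * (1 / sqrt n) + b' * t * (1 / sqrt n)" using 1 2 by linarith
      also have "\<dots> = b' * (1 + t) * (1 / sqrt n)" by (simp only: distrib_left distrib_right mult_1_right)
      finally have "deviation R n (\<lambda>i. Z i \<omega>) h \<le> b' * (1 + t) * (1 / sqrt n)" .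
      
also have "1 / sqrt n = real n powr (- 1 / 2)"
        using n by (simp add: powr_minus_divide powr_half_sqrt)
      finally show ?thesis .
    qed
    ultimately show ?thesis by blast
  qed
  have "\<exists>B\<in>sets M. measure M B \<le> \<epsilon> \<and>
     (\<forall>\<omega>\<in>space M - B. \<bar>deviation R n (\<lambda>i. Z i \<omega>) f\<bar> \<le> b' * (1 + t) * real n powr (- 1 / 2))"
    if n: "1 \<le> n" for n :: nat
  proof -
    have "\<exists>B\<in>sets M. measure M B \<le> \<epsilon> / 2 \<and> (\<forall>\<omega>\<in>space M - B.
        deviation R n (\<lambda>i. Z i \<omega>) f \<le> b' * (1 + t) * real n powr (- 1 / 2))"
      by (rule bound[OF fm _ n]) (rule fb)
    then obtain B1 where B1: "B1 \<in> sets M" "measure M B1 \<le> \<epsilon> / 2"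
      "\<forall>\<omega>\<in>space M - B1. deviation R n (\<lambda>i. Z i \<omega>) f \<le> b' * (1 + t) * real n powr (- 1 / 2)"
      by (elim bexE conjE)
    have "\<exists>B\<in>sets M. measure M B \<le> \<epsilon> / 2 \<and> (\<forall>\<omega>\<in>space M - B.
        deviation R n (\<lambda>i. Z i \<omega>) (\<lambda>x. - f x) \<le> b' * (1 + t) * real n powr (- 1 / 2))"
      by (rule bound[OF _ _ n]) (simp_all add: fb)
    then obtain B2 where B2: "B2 \<in> sets M" "measure M B2 \<le> \<epsilon> / 2"
      "\<forall>\<omega>\<in>space M - B2. deviation R n (\<lambda>i. Z i \<omega>) (\<lambda>x. - f x) \<le> b' * (1 + t) * real n powr (- 1 / 2)"
      by (elim bexE conjE)
    have neg: "deviation R n (\<lambda>i. Z i \<omega>) (\<lambda>x. - f x) = - deviation R n (\<lambda>i. Z i \<omega>) f" for \<omega>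
      by (simp add: deviation_def sum_negf)
    show ?thesis
    proof (rule bexI[of _ "B1 \<union> B2"], intro conjI ballI)
      show "measure M (B1 \<union> B2) \<le> \<epsilon>"
        using measure_Un_le[OF B1(1) B2(1)] B1(2) B2(2) by linarith
      show "\<bar>deviation R n (\<lambda>i. Z i \<omega>) f\<bar> \<le> b' * (1 + t) * real n powr (- 1 / 2)"
        if "\<omega> \<in> space M - (B1 \<union> B2)" for \<omega>
        using bspec[OF B1(3), of \<omega>] bspec[OF B2(3), of \<omega>] that unfolding neg by (simp add: abs_le_iff)
      show "B1 \<union> B2 \<in> sets M" using B1(1) B2(1) by (rule sets.Un)
    qed
  qed
  moreover have "0 \<le> b' * (1 + t)" using b' t by simp
  ultimately show ?thesis by blast
qed

section \<open>Rates of convergence\<close>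

lemma hellinger_dist_le_midpoint:
  assumes Q: "prob_space Q" and g0: "g0 \<in> borel_measurable Q" "\<And>x. x \<in> space Q \<Longrightarrow> 0 < g0 x \<and> g0 x \<le> \<eta>"
    and g: "g \<in> borel_measurable Q" "\<And>x. x \<in> space Q \<Longrightarrow> 0 \<le> g x \<and> g x \<le> b"
  shows "hellinger_dist Q g0 g \<le> sqrt (8 * midpoint_gap Q g0 g)"
proof -
  have bd: "g \<in> bdd_measurable Q b" "g0 \<in> bdd_measurable Q \<eta>"
    using g g0 by (force intro!: bdd_measurableI)+
  have nn: "0 \<le> g x \<and> 0 \<le> g0 x" if "x \<in> space Q" for x using g(2)[OF that] g0(2)[OF that] by simp
  have "(LINT x|Q. (sqrt (g0 x) - sqrt (g x))\<^sup>2) \<le>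
      (LINT x|Q. 16 * (sqrt ((g x + g0 x) / 2) - sqrt (g0 x))\<^sup>2)"
  proof (rule integral_mono')
    show "integrable Q (\<lambda>x. 16 * (sqrt ((g x + g0 x) / 2) - sqrt (g0 x))\<^sup>2)"
      using midpoint_integrable[OF Q bd nn] by simp
    show "(sqrt (g0 x) - sqrt (g x))\<^sup>2 \<le> 16 * (sqrt ((g x + g0 x) / 2) - sqrt (g0 x))\<^sup>2"
      if "x \<in> space Q" for x
      using g(2)[OF that] g0(2)[OF that] by (intro sqrt_diff_le_midpoint) auto
  qed simp
  also have "\<dots> = 16 * midpoint_gap Q g0 g" by (simp add: midpoint_gap_def)
  finally show ?thesis unfolding hellinger_dist_def by simp
qed

text \<open>The three bounds hold off a common exceptional set, so both parts of the theorem draw on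
  the same event. It is assembled from the two deviation events, the lower bound on
  \<open>lam\<close> and a null set covering failures of minimality, all measurable even if the
  minimiser is not.\<close>

lemma penalized_estimator_rates:
  fixes P Q :: "'a measure" and \<Omega> :: "'w measure" and g0 :: "'a \<Rightarrow> real"
    and J :: "('a \<Rightarrow> real) \<Rightarrow> ereal" and \<eta>0 \<eta>1 c \<gamma> A \<epsilon> :: real
  assumes \<Omega>: "prob_space \<Omega>" and X: "iid_sample \<Omega> P X" and Y: "iid_sample \<Omega> Q Y"
    and P: "P = density Q (\<lambda>x. ennreal (g0 x))"
    and D: "\<And>g. g \<in> D \<Longrightarrow> g \<in> borel_measurable Q" "\<And>g x. g \<in> D \<Longrightarrow> x \<in> space Q \<Longrightarrow> 0 \<le> g x"
    and J: "\<forall>g\<in>D. 0 \<le> J g"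
    and lam: "\<And>n \<omega>. \<omega> \<in> space \<Omega> \<Longrightarrow> 0 < lam n \<omega>"
    and g_hat: "\<And>n. 1 \<le> n \<Longrightarrow> AE \<omega> in \<Omega>.
          is_arg_min (penalized_risk J (lam n \<omega>) n (\<lambda>i. X i \<omega>) (\<lambda>i. Y i \<omega>))
            (\<lambda>g. g \<in> complexity_class D J) (g_hat n \<omega>)"
    and g0: "g0 \<in> D" "J g0 < \<infinity>" and \<eta>: "0 < \<eta>0" "\<And>x. x \<in> space Q \<Longrightarrow> \<eta>0 \<le> g0 x \<and> g0 x \<le> \<eta>1"
    and bound: "\<And>M g x. 1 \<le> M \<Longrightarrow> g \<in> complexity_ball D J (ereal M) \<Longrightarrow> x \<in> space Q \<Longrightarrow> g x \<le> c * M"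
    and \<gamma>: "0 < \<gamma>" "\<gamma> < 2" and A: "0 \<le> A"
    and entropy: "\<And>M \<delta>. 1 \<le> M \<Longrightarrow> 0 < \<delta> \<Longrightarrow>
      bracketing_entropy Q \<delta> (complexity_ball D J (ereal M)) \<le> ereal (A * (M / \<delta>) powr \<gamma>)"
    and lam_lower: "bigO_prob \<Omega> (\<lambda>n \<omega>. inverse (lam n \<omega>)) (\<lambda>n \<omega>. real n powr (2 / (2 + \<gamma>)))"
    and \<epsilon>: "0 < \<epsilon>"
  shows "\<exists>K>0. \<forall>\<^sub>F n in sequentially. \<exists>B\<in>sets \<Omega>. measure \<Omega> B \<le> \<epsilon> \<and> (\<forall>\<omega>\<in>space \<Omega> - B.
     hellinger_dist Q g0 (g_hat n \<omega>) \<le> K * sqrt (lam n \<omega>) \<and>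
     log_ratio_gain n (\<lambda>i. X i \<omega>) (\<lambda>i. Y i \<omega>) g0 (g_hat n \<omega>) \<le> K * real n powr (- 2 / (2 + \<gamma>)) \<and>
     - (K * lam n \<omega>) \<le> log_ratio_gain n (\<lambda>i. X i \<omega>) (\<lambda>i. Y i \<omega>) g0 (g_hat n \<omega>))"
proof -
  interpret prob_space \<Omega> by fact
  have Q: "prob_space Q" using iid_sampleD(3)[OF \<Omega> Y] .
  have sP: "sets P = sets Q" "space P = space Q" unfolding P by simp_all
  note [measurable] = D(1)[OF g0(1)]
  \<comment> \<open>One constant bounds \<open>g0\<close>, which is the density of \<open>P\<close>
    under \<open>Q\<close>, and, times \<open>2 ^ j\<close>, every function of ball
    \<open>j\<close>.\<close>
  define b where "b = max 1 (max c \<eta>1)"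
  define G where "G j = complexity_ball D J (ereal (2 ^ j))" for j :: nat
  have GD: "g \<in> D" if "g \<in> G j" for g j using that unfolding G_def complexity_ball_def by blast
  have b: "0 < b" "c \<le> b" "\<eta>1 \<le> b" by (auto simp: b_def)
  have Gb: "0 \<le> g x \<and> g x \<le> b * 2 ^ j" if "g \<in> G j" "x \<in> space Q" for j g x
  proof
    show "0 \<le> g x" using D(2) GD that by blast
    have "g x \<le> c * 2 ^ j" using that unfolding G_def by (intro bound) auto
    also have "\<dots> \<le> b * 2 ^ j" using b by (intro mult_right_mono) auto
    finally show "g x \<le> b * 2 ^ j" .
  qed
  have Gm: "G j \<subseteq> borel_measurable Q" for j using GD D(1) by blast
  have Ge: "bracketing_entropy Q \<delta> (G j) \<le> ereal (A * (2 ^ j / \<delta>) powr \<gamma>)" if "0 < \<delta>" for j \<delta>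
    unfolding G_def using that by (intro entropy) auto
  have g0b: "0 \<le> g0 x \<and> g0 x \<le> b" if "x \<in> space Q" for x
    using \<eta>(2)[OF that] \<eta>(1) b by linarith
  have "\<exists>T\<ge>0. \<forall>a\<ge>1. \<forall>n\<ge>1. \<exists>B\<in>sets \<Omega>. measure \<Omega> B \<le> 4 * exp (- a) \<and>
     (\<forall>\<omega>\<in>space \<Omega> - B. \<forall>j. \<forall>g\<in>G j. deviation P n (\<lambda>i. X i \<omega>) (\<lambda>x. ln ((g x + g0 x) / (2 * g0 x))) \<le>
        midpoint_gap Q g0 g / 4 + T * (a + j) * 2 ^ j * n powr (- 2 / (2 + \<gamma>)))"
  proof (rule composed_deviation[where \<Phi> = "\<lambda>x u. ln ((u + g0 x) / (2 * g0 x))" and \<eta> = b and \<Lambda> = "1 / \<eta>0" and b = b,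
        OF \<Omega> X Q sP(1)])
    show "integrable P w \<and> (LINT x|P. w x) \<le> b * (LINT x|Q. w x)"
      if "\<And>x. x \<in> space Q \<Longrightarrow> 0 \<le> w x" "integrable Q w" for w
      by (rule density_dominated[OF P D(1)[OF g0(1)] g0b that])
    show "\<bar>ln ((u + g0 x) / (2 * g0 x)) - ln ((v + g0 x) / (2 * g0 x))\<bar> \<le> 1 / \<eta>0 * \<bar>u - v\<bar>"
      if "x \<in> space Q" "0 \<le> u" "0 \<le> v" for x u v
      using that \<eta> by (intro ln_midpoint_lipschitz) auto
    show "min (ln ((u + g0 x) / (2 * g0 x))) (ln ((v + g0 x) / (2 * g0 x))) \<le> ln ((y + g0 x) / (2 * g0 x)) \<and>
        ln ((y + g0 x) / (2 * g0 x)) \<le> max (ln ((u + g0 x) / (2 * g0 x))) (ln ((v + g0 x) / (2 * g0 x)))"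
      if x: "x \<in> space Q" and "0 \<le> u" "u \<le> y" "y \<le> v" for x u y v
    proof -
      have p: "0 < g0 x" using \<eta>(1) \<eta>(2)[OF x] by simp
      have "ln ((s + g0 x) / (2 * g0 x)) \<le> ln ((t + g0 x) / (2 * g0 x))" if "0 \<le> s" "s \<le> t" for s t
        using that p by (intro ln_mono divide_right_mono divide_pos_pos) auto
      from this[of u y] this[of y v] show ?thesis using that by (simp add: min_le_iff_disj le_max_iff_disj)
    qed
    show "ln ((g0 x + g0 x) / (2 * g0 x)) = 0" if "x \<in> space Q" for x
      using \<eta>(1) \<eta>(2)[OF that] by simp
  qed (use b \<eta> \<gamma> A g0b Gm Gb Ge D(1)[OF g0(1)] in \<open>simp_all\<close>)
  then obtain T1 where T1: "0 \<le> T1" and dev1: "\<forall>a\<ge>1. \<forall>n\<ge>1. \<exists>B\<in>sets \<Omega>. measure \<Omega> B \<le> 4 * exp (- a) \<and>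
     (\<forall>\<omega>\<in>space \<Omega> - B. \<forall>j. \<forall>g\<in>G j. deviation P n (\<lambda>i. X i \<omega>) (\<lambda>x. ln ((g x + g0 x) / (2 * g0 x))) \<le>
        midpoint_gap Q g0 g / 4 + T1 * (a + j) * 2 ^ j * n powr (- 2 / (2 + \<gamma>)))"
    by (elim exE conjE)
  have "\<exists>T\<ge>0. \<forall>a\<ge>1. \<forall>n\<ge>1. \<exists>B\<in>sets \<Omega>. measure \<Omega> B \<le> 4 * exp (- a) \<and>
     (\<forall>\<omega>\<in>space \<Omega> - B. \<forall>j. \<forall>g\<in>G j. deviation Q n (\<lambda>i. Y i \<omega>) (\<lambda>x. (g0 x - g x) / 2) \<le>
        midpoint_gap Q g0 g / 4 + T * (a + j) * 2 ^ j * n powr (- 2 / (2 + \<gamma>)))"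
  proof (rule composed_deviation[where \<Phi> = "\<lambda>x u. (g0 x - u) / 2" and \<eta> = 1 and \<Lambda> = "1 / 2" and b = b,
        OF \<Omega> Y Q refl])
    show "\<bar>(g0 x - u) / 2 - (g0 x - v) / 2\<bar> \<le> 1 / 2 * \<bar>u - v\<bar>" for x u v by (simp add: abs_if field_simps)
    show "min ((g0 x - u) / 2) ((g0 x - v) / 2) \<le> (g0 x - y) / 2 \<and>
        (g0 x - y) / 2 \<le> max ((g0 x - u) / 2) ((g0 x - v) / 2)" if "u \<le> y" "y \<le> v" for x u y v
      using that by (simp add: min_le_iff_disj le_max_iff_disj)
  qed (use b \<gamma> A g0b Gm Gb Ge D(1)[OF g0(1)] in \<open>simp_all\<close>)
  then obtain T2 where T2: "0 \<le> T2" and dev2: "\<forall>a\<ge>1. \<forall>n\<ge>1. \<exists>B\<in>sets \<Omega>. measure \<Omega> B \<le> 4 * exp (- a) \<and>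
     (\<forall>\<omega>\<in>space \<Omega> - B. \<forall>j. \<forall>g\<in>G j. deviation Q n (\<lambda>i. Y i \<omega>) (\<lambda>x. (g0 x - g x) / 2) \<le>
        midpoint_gap Q g0 g / 4 + T2 * (a + j) * 2 ^ j * n powr (- 2 / (2 + \<gamma>)))"
    by (elim exE conjE)
  define T where "T = T1 + T2"
  have T: "0 \<le> T" using T1 T2 by (simp add: T_def)
  \<comment> \<open>\<epsilon> is shared by three events, two of which have probability up to
    \<open>4 * exp (- a)\<close>; hence the 12.\<close>
  define a where "a = 1 + \<bar>ln (\<epsilon> / 12)\<bar>"
  have a: "1 \<le> a" by (simp add: a_def)
  have ea: "4 * exp (- a) \<le> \<epsilon> / 3"
  proof -
    have "exp (- a) \<le> exp (ln (\<epsilon> / 12))" unfolding a_def exp_le_cancel_iff by linarith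
    then show ?thesis using \<epsilon> by simp
  qed
  have "0 < \<epsilon> / 3" using \<epsilon> by simp
  with lam_lower[unfolded bigO_prob_def]
  obtain Cl where Cl: "0 < Cl" and ev: "\<forall>\<^sub>F n in sequentially. \<exists>A\<in>sets \<Omega>.
      {\<omega> \<in> space \<Omega>. \<bar>inverse (lam n \<omega>)\<bar> > Cl * real n powr (2 / (2 + \<gamma>))} \<subseteq> A \<and> measure \<Omega> A \<le> \<epsilon> / 3"
    by blast
  \<comment> \<open>The order of the choices matters: \<open>T\<close> precedes \<epsilon>, then
    \<open>a\<close> and \<open>Cl\<close> come from \<epsilon>, \<open>e\<close> from
    \<open>T\<close> and \<open>Cl\<close>, and finally \<open>C\<close> from \<open>e\<close> and
    \<open>a\<close>. None of them depends on \<open>n\<close>.\<close>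
  define e where "e = 1 / (64 * (T + 1) * Cl)"
  have "0 < e" using T Cl by (simp add: e_def)
  from linear_times_dyadic_bound[OF this, of a]
  obtain C where C: "0 \<le> C" "\<And>j::nat. (a + j) * 2 ^ j \<le> e * (2 ^ j)\<^sup>2 + C" by blast
  define I0 where "I0 = real_of_ereal (J g0)"
  define K1 where "K1 = I0\<^sup>2 / 2 + 2 * T * (8 * e + C) * Cl"
  define K2 where "K2 = 2 * T * (8 * e + C + 32 * e * K1)"
  define K where "K = sqrt (8 * K1) + K1 + K2 + 1"
  have K1: "0 \<le> K1" using T C Cl \<open>0 < e\<close> by (simp add: K1_def)
  have K2: "0 \<le> K2" using T C K1 \<open>0 < e\<close> by (simp add: K2_def)
  have K: "0 < K" "K1 \<le> K" "K2 \<le> K" "sqrt (8 * K1) \<le> K"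
  proof -
    have "0 \<le> sqrt (8 * K1)" using K1 by simp
    then show "0 < K" "K1 \<le> K" "K2 \<le> K" "sqrt (8 * K1) \<le> K" using K1 K2 unfolding K_def by linarith+
  qed
  have "\<exists>B\<in>sets \<Omega>. measure \<Omega> B \<le> \<epsilon> \<and> (\<forall>\<omega>\<in>space \<Omega> - B.
     hellinger_dist Q g0 (g_hat n \<omega>) \<le> K * sqrt (lam n \<omega>) \<and>
     log_ratio_gain n (\<lambda>i. X i \<omega>) (\<lambda>i. Y i \<omega>) g0 (g_hat n \<omega>) \<le> K * real n powr (- 2 / (2 + \<gamma>)) \<and>
     - (K * lam n \<omega>) \<le> log_ratio_gain n (\<lambda>i. X i \<omega>) (\<lambda>i. Y i \<omega>) g0 (g_hat n \<omega>))"
    if n: "1 \<le> n" and evn: "\<exists>A\<in>sets \<Omega>. {\<omega> \<in> space \<Omega>. \<bar>inverse (lam n \<omega>)\<bar> > Cl * real n powr (2 / (2 + \<gamma>))} \<subseteq> A \<and>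
      measure \<Omega> A \<le> \<epsilon> / 3" for n
  proof -
    let ?d = "real n powr (- 2 / (2 + \<gamma>))"
    from evn obtain B0 where B0: "B0 \<in> sets \<Omega>" "measure \<Omega> B0 \<le> \<epsilon> / 3"
      and lamB: "{\<omega> \<in> space \<Omega>. \<bar>inverse (lam n \<omega>)\<bar> > Cl * real n powr (2 / (2 + \<gamma>))} \<subseteq> B0"
      by (elim bexE conjE)
    from dev1[rule_format, OF a n] obtain B1 where B1: "B1 \<in> sets \<Omega>" "measure \<Omega> B1 \<le> 4 * exp (- a)"
      and d1: "\<forall>\<omega>\<in>space \<Omega> - B1. \<forall>j. \<forall>g\<in>G j. deviation P n (\<lambda>i. X i \<omega>) (\<lambda>x. ln ((g x + g0 x) / (2 * g0 x))) \<le>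
        midpoint_gap Q g0 g / 4 + T1 * (a + j) * 2 ^ j * ?d"
      by (elim bexE conjE)
    from dev2[rule_format, OF a n] obtain B2 where B2: "B2 \<in> sets \<Omega>" "measure \<Omega> B2 \<le> 4 * exp (- a)"
      and d2: "\<forall>\<omega>\<in>space \<Omega> - B2. \<forall>j. \<forall>g\<in>G j. deviation Q n (\<lambda>i. Y i \<omega>) (\<lambda>x. (g0 x - g x) / 2) \<le>
        midpoint_gap Q g0 g / 4 + T2 * (a + j) * 2 ^ j * ?d"
      by (elim bexE conjE)
    from g_hat[OF n] obtain B3 where B3: "B3 \<in> null_sets \<Omega>"
      and amin: "{\<omega>\<in>space \<Omega>. \<not> is_arg_min (penalized_risk J (lam n \<omega>) n (\<lambda>i. X i \<omega>) (\<lambda>i. Y i \<omega>))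
            (\<lambda>g. g \<in> complexity_class D J) (g_hat n \<omega>)} \<subseteq> B3"
      by (auto elim!: AE_E)
    have m3: "B3 \<in> sets \<Omega>" "measure \<Omega> B3 = 0"
      using B3 by (auto simp: null_sets_def measure_def)
    define B where "B = B0 \<union> (B1 \<union> (B2 \<union> B3))"
    have Bm: "B \<in> sets \<Omega>" unfolding B_def using B0 B1 B2 m3 by blast
    have "measure \<Omega> B \<le> measure \<Omega> B0 + (measure \<Omega> B1 + (measure \<Omega> B2 + measure \<Omega> B3))"
      unfolding B_def using B0(1) B1(1) B2(1) m3(1)
      by (intro order_trans[OF measure_Un_le] add_left_mono) auto
    also have "\<dots> \<le> \<epsilon>" using B0(2) B1(2) B2(2) m3(2) ea by linarith
    finally have MB: "measure \<Omega> B \<le> \<epsilon>" .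
    have "hellinger_dist Q g0 (g_hat n \<omega>) \<le> K * sqrt (lam n \<omega>) \<and>
     log_ratio_gain n (\<lambda>i. X i \<omega>) (\<lambda>i. Y i \<omega>) g0 (g_hat n \<omega>) \<le> K * ?d \<and>
     - (K * lam n \<omega>) \<le> log_ratio_gain n (\<lambda>i. X i \<omega>) (\<lambda>i. Y i \<omega>) g0 (g_hat n \<omega>)"
      if \<omega>: "\<omega> \<in> space \<Omega> - B" for \<omega>
    proof -
      let ?x = "\<lambda>i. X i \<omega>" and ?y = "\<lambda>i. Y i \<omega>"
      define g where "g = g_hat n \<omega>"
      define l where "l = lam n \<omega>"
      have w: "\<omega> \<in> space \<Omega>" "\<omega> \<in> space \<Omega> - B1" "\<omega> \<in> space \<Omega> - B2" "\<omega> \<notin> B0" "\<omega> \<notin> B3"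
        using \<omega> unfolding B_def by auto
      have l: "0 < l" unfolding l_def by (rule lam[OF w(1)])
      have xs: "?x i \<in> space Q" for i
        using measurable_space[OF iid_sampleD(1)[OF \<Omega> X] w(1)] sP(2) by simp
      have am: "is_arg_min (penalized_risk J l n ?x ?y) (\<lambda>g. g \<in> complexity_class D J) g"
        using amin w(1,5) unfolding g_def l_def by blast
      have g0x: "0 < g0 (?x i)" for i using \<eta>(1) \<eta>(2)[OF xs[of i]] by linarith
      have n0: "0 < n" using n by simp
      note pm = penalized_minimizer[OF am n0 l J g0 g0x]
      define I where "I = real_of_ereal (J g)"
      have "0 \<le> J g" using J pm(1) by blast
      then have I: "0 \<le> I" "J g = ereal I"
        using pm(2) unfolding I_def by (cases "J g"; simp)+
      \<comment> \<open>The ball depends on \<omega>; this is harmless because \<open>B1\<close> and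
        \<open>B2\<close> serve all \<open>j\<close> at once.\<close>
      obtain j :: nat where j: "I \<le> 2 ^ j" "2 ^ j \<le> 2 * (1 + I)" using dyadic_radius[OF I(1)] by blast
      have gG: "g \<in> G j" using pm(1) I j by (simp add: G_def complexity_ball_def)
      have gm: "g \<in> borel_measurable Q" by (rule D(1)[OF pm(1)])
      define gap where "gap = midpoint_gap Q g0 g"
      define gain where "gain = log_ratio_gain n ?x ?y g0 g"
      have gap0: "0 \<le> gap" unfolding gap_def midpoint_gap_def by simp
      have "gain \<le> 2 * (deviation P n ?x (\<lambda>z. ln ((g z + g0 z) / (2 * g0 z))) +
          deviation Q n ?y (\<lambda>z. (g0 z - g z) / 2)) - 2 * gap"
        unfolding gain_def gap_def
        by (rule log_ratio_gain_le[OF Q P \<eta>(1) D(1)[OF g0(1)] \<eta>(2) gm Gb[OF gG] xs pm(3)])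
      moreover have "deviation P n ?x (\<lambda>z. ln ((g z + g0 z) / (2 * g0 z))) \<le>
          gap / 4 + T1 * (a + j) * 2 ^ j * ?d"
        unfolding gap_def using d1 w(2) gG by blast
      moreover have "deviation Q n ?y (\<lambda>z. (g0 z - g z) / 2) \<le> gap / 4 + T2 * (a + j) * 2 ^ j * ?d"
        unfolding gap_def using d2 w(3) gG by blast
      moreover have "T * (a + j) * 2 ^ j * ?d = T1 * (a + j) * 2 ^ j * ?d + T2 * (a + j) * 2 ^ j * ?d"
        unfolding T_def by (simp only: distrib_right)
      \<comment> \<open>Two quarters of the gap, doubled, cancel one of the two gaps supplied by
        \<open>log_ratio_gain_le\<close>.\<close>
      ultimately have up: "gain \<le> - gap + 2 * (T * (a + j) * 2 ^ j * ?d)" by argo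
      have low: "l / 2 * (I\<^sup>2 - I0\<^sup>2) \<le> gain"
        using pm(4) unfolding I_def I0_def gain_def .
      have dl: "?d \<le> Cl * l"
      proof -
        have "\<bar>inverse l\<bar> \<le> Cl * real n powr (2 / (2 + \<gamma>))"
          using lamB w(1,4) unfolding l_def by (auto simp: not_less)
        then have "l * inverse l \<le> l * (Cl * real n powr (2 / (2 + \<gamma>)))"
          using l by (intro mult_left_mono) auto
        then have "1 * ?d \<le> l * (Cl * real n powr (2 / (2 + \<gamma>))) * ?d"
          using l by (intro mult_right_mono) auto
        also have "\<dots> = Cl * l * (real n powr (2 / (2 + \<gamma>)) * ?d)" by (simp only: mult_ac)
        also have "real n powr (2 / (2 + \<gamma>)) * ?d = 1"
          using n by (simp flip: powr_add add_divide_distrib)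
        finally show ?thesis by simp
      qed
      note abs = penalty_absorbs[OF gap0 l I(1) j(2) C(2) powr_ge_zero dl Cl T C(1) e_def up low K1_def]
      have "hellinger_dist Q g0 g \<le> sqrt (8 * gap)"
        unfolding gap_def
      proof (rule hellinger_dist_le_midpoint[OF Q D(1)[OF g0(1)] _ gm Gb[OF gG]])
        show "0 < g0 x \<and> g0 x \<le> \<eta>1" if "x \<in> space Q" for x
          using \<eta>(1) \<eta>(2)[OF that] by linarith
      qed
      also have "\<dots> \<le> sqrt (8 * (K1 * l))" using abs(1) by simp
      also have "\<dots> = sqrt (8 * K1) * sqrt l" by (simp add: real_sqrt_mult)
      also have "\<dots> \<le> K * sqrt l" using K l by (intro mult_right_mono) auto
      finally have 1: "hellinger_dist Q g0 g \<le> K * sqrt l" .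
      have "gain \<le> K2 * ?d" using abs(2) unfolding K2_def .
      also have "\<dots> \<le> K * ?d" using K by (intro mult_right_mono) auto
      finally have 2: "gain \<le> K * ?d" .
      have "K1 * l \<le> K * l" using K l by (intro mult_right_mono) auto
      then have 3: "- (K * l) \<le> gain" using abs(3) by linarith
      show ?thesis using 1 2 3 unfolding gain_def g_def l_def by blast
    qed
    then show ?thesis using Bm MB by blast
  qed
  then have "\<forall>\<^sub>F n in sequentially. \<exists>B\<in>sets \<Omega>. measure \<Omega> B \<le> \<epsilon> \<and> (\<forall>\<omega>\<in>space \<Omega> - B.
     hellinger_dist Q g0 (g_hat n \<omega>) \<le> K * sqrt (lam n \<omega>) \<and>
     log_ratio_gain n (\<lambda>i. X i \<omega>) (\<lambda>i. Y i \<omega>) g0 (g_hat n \<omega>) \<le> K * real n powr (- 2 / (2 + \<gamma>)) \<and>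
     - (K * lam n \<omega>) \<le> log_ratio_gain n (\<lambda>i. X i \<omega>) (\<lambda>i. Y i \<omega>) g0 (g_hat n \<omega>))"
    by (rule eventually_elim2[OF eventually_ge_at_top[of 1] ev])
  then show ?thesis using K(1) by blast
qed

lemma powr_rate_le:
  assumes "0 < \<gamma>" "\<gamma> < 2" "1 \<le> n"
  shows "real n powr (- 2 / (2 + \<gamma>)) \<le> real n powr (- 1 / 2)"
  using assms by (intro powr_mono) (auto simp: field_simps)

section \<open>Likelihood ratio and divergence\<close>

text \<open>Where \<open>q\<close> vanishes, the value of \<open>g\<close> is not tied to
  \<open>p\<close>. By absolute continuity \<open>p\<close> vanishes there almost everywhere, so
  \<open>p = q * g\<close> holds almost everywhere all the same.\<close>

lemma density_ratio:
  assumes p: "p \<in> borel_measurable \<mu>" "\<And>x. x \<in> space \<mu> \<Longrightarrow> 0 \<le> p x"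
    and q: "q \<in> borel_measurable \<mu>" "\<And>x. x \<in> space \<mu> \<Longrightarrow> 0 \<le> q x"
    and ac: "absolutely_continuous (density \<mu> (\<lambda>x. ennreal (q x))) (density \<mu> (\<lambda>x. ennreal (p x)))"
    and g: "g \<in> borel_measurable \<mu>" "\<And>x. x \<in> space \<mu> \<Longrightarrow> 0 \<le> g x"
      "\<And>x. x \<in> space \<mu> \<Longrightarrow> q x \<noteq> 0 \<Longrightarrow> g x = p x / q x"
  shows "AE x in \<mu>. q x = 0 \<longrightarrow> p x = 0"
    and "density \<mu> (\<lambda>x. ennreal (p x)) = density (density \<mu> (\<lambda>x. ennreal (q x))) (\<lambda>x. ennreal (g x))"
proof -
  note [measurable] = p(1) q(1) g(1)
  let ?A = "{x \<in> space \<mu>. q x = 0}"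
  have A: "?A \<in> sets \<mu>" by measurable
  have "?A \<in> null_sets (density \<mu> (\<lambda>x. ennreal (q x)))"
    using A by (subst null_sets_density_iff) auto
  then have "?A \<in> null_sets (density \<mu> (\<lambda>x. ennreal (p x)))"
    using ac by (auto simp: absolutely_continuous_def)
  then have "AE x in \<mu>. x \<in> ?A \<longrightarrow> ennreal (p x) = 0"
    by (subst (asm) null_sets_density_iff) auto
  then show ae: "AE x in \<mu>. q x = 0 \<longrightarrow> p x = 0"
    using AE_space by eventually_elim (use p(2) in \<open>auto simp: ennreal_eq_0_iff intro: antisym\<close>)
  have "AE x in \<mu>. ennreal (p x) = ennreal (q x) * ennreal (g x)"
    using ae AE_space
  proof eventually_elim
    case (elim x)
    then have "p x = q x * g x" using g(3)[of x] by (cases "q x = 0") auto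
    then show ?case using q(2)[of x] elim by (simp add: ennreal_mult' )
  qed
  then have "density \<mu> (\<lambda>x. ennreal (p x)) = density \<mu> (\<lambda>x. ennreal (q x) * ennreal (g x))"
    by (intro density_cong) auto
  also have "\<dots> = density (density \<mu> (\<lambda>x. ennreal (q x))) (\<lambda>x. ennreal (g x))"
    by (intro density_density_eq[symmetric]) auto
  finally show "density \<mu> (\<lambda>x. ennreal (p x)) = density (density \<mu> (\<lambda>x. ennreal (q x))) (\<lambda>x. ennreal (g x))" .
qed

text \<open>The \<open>+ 1\<close> in the estimator is the mean of \<open>g0\<close> under
  \<open>Q\<close>. With it, the error splits into the gain over \<open>g0\<close> and the
  fluctuations of two fixed functions, which do not involve the minimiser.\<close>

lemma kl_estimate_error:
  assumes "(LINT x|Q. g0 x) = 1" and "KL_divergence (exp 1) Q P = (LINT x|P. ln (g0 x))"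
  shows "kl_estimate n x y g - KL_divergence (exp 1) Q P =
     log_ratio_gain n x y g0 g + deviation P n x (\<lambda>z. ln (g0 z)) - deviation Q n y g0"
  using assms unfolding kl_estimate_def log_ratio_gain_def deviation_def
  by (simp add: sum_subtractf diff_divide_distrib)

theorem theorem3:
  fixes \<X> :: "'a::euclidean_space set"
    and p0 q0 g0 :: "'a \<Rightarrow> real"
    and P Q :: "'a measure"
    and \<Omega> :: "'w measure"
    and X Y :: "nat \<Rightarrow> 'w \<Rightarrow> 'a"
    and D :: "('a \<Rightarrow> real) set"
    and J :: "('a \<Rightarrow> real) \<Rightarrow> ereal"
    and lam :: "nat \<Rightarrow> 'w \<Rightarrow> real"
    and g_hat :: "nat \<Rightarrow> 'w \<Rightarrow> 'a \<Rightarrow> real"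
    and \<eta>0 \<eta>1 c \<gamma> :: real
  assumes "compact \<X>"
    and "p0 \<in> borel_measurable (restrict_space lborel \<X>)" "\<forall>x\<in>\<X>. 0 \<le> p0 x"
    and "q0 \<in> borel_measurable (restrict_space lborel \<X>)" "\<forall>x\<in>\<X>. 0 \<le> q0 x"
    and "P = density (restrict_space lborel \<X>) (\<lambda>x. ennreal (p0 x))" "prob_space P"
    and "Q = density (restrict_space lborel \<X>) (\<lambda>x. ennreal (q0 x))" "prob_space Q"
    and "absolutely_continuous Q P"
    and g0: "\<forall>x\<in>\<X>. q0 x \<noteq> 0 \<longrightarrow> g0 x = p0 x / q0 x"
    and "prob_space \<Omega>" "iid_sample \<Omega> P X" "iid_sample \<Omega> Q Y"
    and "\<forall>g\<in>D. g \<in> borel_measurable (restrict_space lborel \<X>) \<and> (\<forall>x\<in>\<X>. 0 \<le> g x)"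
    and "\<forall>g\<in>D. 0 \<le> J g"
    and lam: "\<forall>n. lam n \<in> borel_measurable \<Omega>" "\<forall>n. \<forall>\<omega>\<in>space \<Omega>. 0 < lam n \<omega>"
    and g_hat: "\<forall>n\<ge>1. AE \<omega> in \<Omega>.
          is_arg_min (penalized_risk J (lam n \<omega>) n (\<lambda>i. X i \<omega>) (\<lambda>i. Y i \<omega>))
            (\<lambda>g. g \<in> complexity_class D J) (g_hat n \<omega>)"
    and i: "g0 \<in> D" "J g0 < \<infinity>"
    and ii: "0 < \<eta>0" "\<forall>x\<in>\<X>. \<eta>0 \<le> g0 x \<and> g0 x \<le> \<eta>1"
    and iii: "\<forall>M\<ge>1. (SUP g\<in>complexity_ball D J (ereal M). SUP x\<in>\<X>. ereal \<bar>g x\<bar>) \<le> ereal (c * M)"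
    and iv: "0 < \<gamma>" "\<gamma> < 2"
      "\<exists>A. \<forall>M\<ge>1. \<forall>\<delta>>0. bracketing_entropy Q \<delta> (complexity_ball D J (ereal M))
          \<le> ereal (A * (M / \<delta>) powr \<gamma>)"
    and lam_to_0: "\<forall>\<epsilon>>0. (\<lambda>n. measure \<Omega> {\<omega>\<in>space \<Omega>. lam n \<omega> > \<epsilon>}) \<longlonglongrightarrow> 0"
    and lam_lower: "bigO_prob \<Omega> (\<lambda>n \<omega>. inverse (lam n \<omega>)) (\<lambda>n \<omega>. real n powr (2 / (2 + \<gamma>)))"
  shows
    "bigO_prob \<Omega> (\<lambda>n \<omega>. hellinger_dist Q g0 (g_hat n \<omega>)) (\<lambda>n \<omega>. sqrt (lam n \<omega>))
     \<and>
     (ereal \<eta>0 \<le> (INF x\<in>\<X>. INF g\<in>complexity_class D J. ereal (g x)) \<and>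
        bigO_prob \<Omega> lam (\<lambda>n \<omega>. real n powr (- 1 / 2)) \<longrightarrow>
      bigO_prob \<Omega>
        (\<lambda>n \<omega>. kl_estimate n (\<lambda>i. X i \<omega>) (\<lambda>i. Y i \<omega>) (g_hat n \<omega>) - KL_divergence (exp 1) Q P)
        (\<lambda>n \<omega>. real n powr (- 1 / 2)))"
proof -
  define \<mu> where "\<mu> = restrict_space lborel \<X>"
  have sp\<mu>: "space \<mu> = \<X>" unfolding \<mu>_def by (simp add: space_restrict_space)
  note P = \<open>P = _\<close>[folded \<mu>_def] and Q = \<open>Q = _\<close>[folded \<mu>_def]
  note p0 = assms(2)[folded \<mu>_def] assms(3)[folded sp\<mu>, rule_format]
  note q0 = assms(4)[folded \<mu>_def] assms(5)[folded sp\<mu>, rule_format]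
  have spQ: "space Q = \<X>" and mQ: "borel_measurable Q = borel_measurable \<mu>"
    unfolding Q by (auto simp: sp\<mu> intro!: measurable_cong_sets)
  have D: "\<And>g. g \<in> D \<Longrightarrow> g \<in> borel_measurable Q" "\<And>g x. g \<in> D \<Longrightarrow> x \<in> space Q \<Longrightarrow> 0 \<le> g x"
    using \<open>\<forall>g\<in>D. g \<in> borel_measurable (restrict_space lborel \<X>) \<and> (\<forall>x\<in>\<X>. 0 \<le> g x)\<close>
    unfolding mQ spQ \<mu>_def by blast+
  have \<eta>: "\<eta>0 \<le> g0 x \<and> g0 x \<le> \<eta>1" if "x \<in> space Q" for x using ii(2) that spQ by blast
  have g0m: "g0 \<in> borel_measurable \<mu>" using D(1)[OF i(1)] unfolding mQ .
  have g0pos: "0 < g0 x" if "x \<in> \<X>" for x using ii that by force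
  have ac: "absolutely_continuous (density \<mu> (\<lambda>x. ennreal (q0 x))) (density \<mu> (\<lambda>x. ennreal (p0 x)))"
    using \<open>absolutely_continuous Q P\<close> unfolding P Q .
  have "g0 x = p0 x / q0 x" if "x \<in> space \<mu>" "q0 x \<noteq> 0" for x using g0 that sp\<mu> by blast
  moreover have "0 \<le> g0 x" if "x \<in> space \<mu>" for x using g0pos[of x] that sp\<mu> by simp
  ultimately have ratio: "AE x in \<mu>. q0 x = 0 \<longrightarrow> p0 x = 0"
    "density \<mu> (\<lambda>x. ennreal (p0 x)) = density (density \<mu> (\<lambda>x. ennreal (q0 x))) (\<lambda>x. ennreal (g0 x))"
    using density_ratio[OF p0 q0 ac g0m] by blast+
  have PQ: "P = density Q (\<lambda>x. ennreal (g0 x))" using ratio(2) unfolding P[symmetric] Q[symmetric] .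
  have prP: "prob_space P" and prQ: "prob_space Q" by fact+
  have bound: "g x \<le> c * M" if "1 \<le> M" "g \<in> complexity_ball D J (ereal M)" "x \<in> space Q" for M g x
  proof -
    have "ereal \<bar>g x\<bar> \<le> (SUP x\<in>\<X>. ereal \<bar>g x\<bar>)" using that(3) spQ by (intro SUP_upper) auto
    also have "\<dots> \<le> (SUP g\<in>complexity_ball D J (ereal M). SUP x\<in>\<X>. ereal \<bar>g x\<bar>)"
      using that(2) by (rule SUP_upper)
    also have "\<dots> \<le> ereal (c * M)" using iii that(1) by blast
    finally show ?thesis by simp
  qed
  obtain A where A: "\<forall>M\<ge>1. \<forall>\<delta>>0. bracketing_entropy Q \<delta> (complexity_ball D J (ereal M))
      \<le> ereal (A * (M / \<delta>) powr \<gamma>)"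
    using iv(3) by blast
  \<comment> \<open>The constant behind the O-bound may be negative, while the chaining argument
    works with a nonnegative one.\<close>
  have entropy: "bracketing_entropy Q \<delta> (complexity_ball D J (ereal M)) \<le> ereal (max A 0 * (M / \<delta>) powr \<gamma>)"
    if "1 \<le> M" "0 < \<delta>" for M \<delta>
  proof -
    have "bracketing_entropy Q \<delta> (complexity_ball D J (ereal M)) \<le> ereal (A * (M / \<delta>) powr \<gamma>)"
      using A that by blast
    also have "\<dots> \<le> ereal (max A 0 * (M / \<delta>) powr \<gamma>)"
      unfolding ereal_less_eq by (intro mult_right_mono) auto
    finally show ?thesis .
  qed
  have rates: "\<exists>K>0. \<forall>\<^sub>F n in sequentially. \<exists>B\<in>sets \<Omega>. measure \<Omega> B \<le> \<epsilon> \<and> (\<forall>\<omega>\<in>space \<Omega> - B.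
     hellinger_dist Q g0 (g_hat n \<omega>) \<le> K * sqrt (lam n \<omega>) \<and>
     log_ratio_gain n (\<lambda>i. X i \<omega>) (\<lambda>i. Y i \<omega>) g0 (g_hat n \<omega>) \<le> K * real n powr (- 2 / (2 + \<gamma>)) \<and>
     - (K * lam n \<omega>) \<le> log_ratio_gain n (\<lambda>i. X i \<omega>) (\<lambda>i. Y i \<omega>) g0 (g_hat n \<omega>))"
    if "0 < \<epsilon>" for \<epsilon>
  proof (rule penalized_estimator_rates[where P = P and D = D and J = J and A = "max A 0" and c = c
        and ?\<eta>0.0 = \<eta>0 and ?\<eta>1.0 = \<eta>1])
    show "0 < lam n \<omega>" if "\<omega> \<in> space \<Omega>" for n \<omega> using lam(2) that by blast
    show "AE \<omega> in \<Omega>. is_arg_min (penalized_risk J (lam n \<omega>) n (\<lambda>i. X i \<omega>) (\<lambda>i. Y i \<omega>))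
            (\<lambda>g. g \<in> complexity_class D J) (g_hat n \<omega>)" if "1 \<le> n" for n using g_hat that by blast
    show "g \<in> borel_measurable Q" if "g \<in> D" for g using that by (rule D(1))
    show "0 \<le> g x" if "g \<in> D" "x \<in> space Q" for g x using that by (rule D(2))
    show "\<eta>0 \<le> g0 x \<and> g0 x \<le> \<eta>1" if "x \<in> space Q" for x using that by (rule \<eta>)
    show "g x \<le> c * M" if "1 \<le> M" "g \<in> complexity_ball D J (ereal M)" "x \<in> space Q" for M g x
      using that by (rule bound)
    show "bracketing_entropy Q \<delta> (complexity_ball D J (ereal M)) \<le> ereal (max A 0 * (M / \<delta>) powr \<gamma>)"
      if "1 \<le> M" "0 < \<delta>" for M \<delta> using that by (rule entropy)
  qed (fact PQ i ii(1) iv(1,2) lam_lower that assms max.cobounded2)+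
  have "bigO_prob \<Omega> (\<lambda>n \<omega>. hellinger_dist Q g0 (g_hat n \<omega>)) (\<lambda>n \<omega>. sqrt (lam n \<omega>))"
    unfolding bigO_prob_def
  proof (intro allI impI)
    fix \<epsilon> :: real assume "0 < \<epsilon>"
    from rates[OF this] obtain K where K: "0 < K" and ev: "\<forall>\<^sub>F n in sequentially. \<exists>B\<in>sets \<Omega>. measure \<Omega> B \<le> \<epsilon> \<and>
     (\<forall>\<omega>\<in>space \<Omega> - B. hellinger_dist Q g0 (g_hat n \<omega>) \<le> K * sqrt (lam n \<omega>) \<and>
     log_ratio_gain n (\<lambda>i. X i \<omega>) (\<lambda>i. Y i \<omega>) g0 (g_hat n \<omega>) \<le> K * real n powr (- 2 / (2 + \<gamma>)) \<and>
     - (K * lam n \<omega>) \<le> log_ratio_gain n (\<lambda>i. X i \<omega>) (\<lambda>i. Y i \<omega>) g0 (g_hat n \<omega>))"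
      by (elim exE conjE)
    have nonneg: "0 \<le> hellinger_dist Q g0 g" for g by (simp add: hellinger_dist_def)
    have "\<forall>\<^sub>F n in sequentially. \<exists>A\<in>sets \<Omega>. {\<omega> \<in> space \<Omega>.
        \<bar>hellinger_dist Q g0 (g_hat n \<omega>)\<bar> > K * sqrt (lam n \<omega>)} \<subseteq> A \<and> measure \<Omega> A \<le> \<epsilon>"
      using ev
    proof eventually_elim
      case (elim n)
      then obtain B where B: "B \<in> sets \<Omega>" "measure \<Omega> B \<le> \<epsilon>"
        and d: "\<forall>\<omega>\<in>space \<Omega> - B. hellinger_dist Q g0 (g_hat n \<omega>) \<le> K * sqrt (lam n \<omega>)"
        by blast
      have "{\<omega> \<in> space \<Omega>. \<bar>hellinger_dist Q g0 (g_hat n \<omega>)\<bar> > K * sqrt (lam n \<omega>)} \<subseteq> B"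
        using d nonneg by (auto simp: not_le[symmetric])
      then show ?case using B by blast
    qed
    then show "\<exists>C>0. \<forall>\<^sub>F n in sequentially. \<exists>A\<in>sets \<Omega>. {\<omega> \<in> space \<Omega>.
        \<bar>hellinger_dist Q g0 (g_hat n \<omega>)\<bar> > C * sqrt (lam n \<omega>)} \<subseteq> A \<and> measure \<Omega> A \<le> \<epsilon>"
      using K by blast
  qed
  moreover have "bigO_prob \<Omega>
        (\<lambda>n \<omega>. kl_estimate n (\<lambda>i. X i \<omega>) (\<lambda>i. Y i \<omega>) (g_hat n \<omega>) - KL_divergence (exp 1) Q P)
        (\<lambda>n \<omega>. real n powr (- 1 / 2))"
    if lam_upper: "bigO_prob \<Omega> lam (\<lambda>n \<omega>. real n powr (- 1 / 2))"
  proof -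
    interpret P: prob_space P by fact
    have g0Q: "g0 \<in> borel_measurable Q" by (rule D(1)[OF i(1)])
    have nnQ: "AE x in Q. 0 \<le> g0 x" using \<eta> ii(1) by (intro AE_I2) force
    have "(LINT x|P. 1 :: real) = (LINT x|Q. g0 x *\<^sub>R 1)"
      unfolding PQ by (rule integral_density[OF _ g0Q nnQ]) simp
    then have mass: "(LINT x|Q. g0 x) = 1" by (simp add: P.prob_space)
    have "KL_divergence (exp 1) Q P = (LINT x|\<mu>. p0 x * ln (p0 x / q0 x))"
      unfolding P Q \<mu>_def
      by (rule KL_divergence_densities)
        (use assms(1-5) ac in \<open>auto simp: \<mu>_def\<close>)
    also have "\<dots> = (LINT x|\<mu>. p0 x *\<^sub>R ln (g0 x))"
    proof (rule integral_cong_AE)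
      \<comment> \<open>Where \<open>q0\<close> vanishes the quotient is 0 by convention and
        \<open>g0\<close> is some other value, but the factor \<open>p0 x\<close> is 0 almost
        everywhere on that set.\<close>
      show "AE x in \<mu>. p0 x * ln (p0 x / q0 x) = p0 x *\<^sub>R ln (g0 x)"
        using ratio(1) AE_space
      proof eventually_elim
        case (elim x)
        then show ?case using g0 sp\<mu> by (cases "q0 x = 0") auto
      qed
    qed (use p0(1) q0(1) g0m in measurable)
    also have "\<dots> = (LINT x|P. ln (g0 x))"
      unfolding P using p0 g0m by (intro integral_density[symmetric]) auto
    finally have KL: "KL_divergence (exp 1) Q P = (LINT x|P. ln (g0 x))" .
    have spP: "space P = space Q" "borel_measurable P = borel_measurable Q"
      unfolding PQ by (auto intro!: measurable_cong_sets)
    have lnb: "(\<lambda>x. ln (g0 x)) \<in> bdd_measurable P (\<bar>ln \<eta>0\<bar> + \<bar>ln \<eta>1\<bar>)"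
    proof (rule bdd_measurableI)
      show "(\<lambda>x. ln (g0 x)) \<in> borel_measurable P" unfolding spP using g0Q by measurable
      fix x assume "x \<in> space P"
      then have "\<eta>0 \<le> g0 x" "g0 x \<le> \<eta>1" using \<eta> spP(1) by auto
      then have "ln \<eta>0 \<le> ln (g0 x)" "ln (g0 x) \<le> ln \<eta>1" using ii(1) by (auto intro!: ln_mono)
      then show "\<bar>ln (g0 x)\<bar> \<le> \<bar>ln \<eta>0\<bar> + \<bar>ln \<eta>1\<bar>" by linarith
    qed
    have g0bd: "g0 \<in> bdd_measurable Q \<eta>1"
    proof (rule bdd_measurableI[OF g0Q])
      fix x assume "x \<in> space Q"
      from \<eta>[OF this] show "\<bar>g0 x\<bar> \<le> \<eta>1" using ii(1) by linarith
    qed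
    note err = kl_estimate_error[OF mass KL]
    show ?thesis unfolding bigO_prob_def
    proof (intro allI impI)
      fix \<epsilon> :: real assume "0 < \<epsilon>"
      then have \<epsilon>: "0 < \<epsilon> / 4" by simp
      let ?r = "\<lambda>n. real n powr (- 1 / 2)"
      from rates[OF \<epsilon>] obtain K where K: "0 < K" and ev: "\<forall>\<^sub>F n in sequentially. \<exists>B\<in>sets \<Omega>. measure \<Omega> B \<le> \<epsilon> / 4 \<and>
       (\<forall>\<omega>\<in>space \<Omega> - B. hellinger_dist Q g0 (g_hat n \<omega>) \<le> K * sqrt (lam n \<omega>) \<and>
       log_ratio_gain n (\<lambda>i. X i \<omega>) (\<lambda>i. Y i \<omega>) g0 (g_hat n \<omega>) \<le> K * real n powr (- 2 / (2 + \<gamma>)) \<and>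
       - (K * lam n \<omega>) \<le> log_ratio_gain n (\<lambda>i. X i \<omega>) (\<lambda>i. Y i \<omega>) g0 (g_hat n \<omega>))"
        by (elim exE conjE)
      from lam_upper[unfolded bigO_prob_def, rule_format, OF \<epsilon>]
      obtain L where L: "0 < L" and evl: "\<forall>\<^sub>F n in sequentially.
          \<exists>A\<in>sets \<Omega>. {\<omega> \<in> space \<Omega>. \<bar>lam n \<omega>\<bar> > L * ?r n} \<subseteq> A \<and> measure \<Omega> A \<le> \<epsilon> / 4"
        by (elim exE conjE)
      from deviation_root_n[OF \<open>prob_space \<Omega>\<close> \<open>iid_sample \<Omega> P X\<close> lnb \<epsilon>]
      obtain C1 where C1: "0 \<le> C1" and dP: "\<forall>n\<ge>1. \<exists>B\<in>sets \<Omega>. measure \<Omega> B \<le> \<epsilon> / 4 \<and>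
         (\<forall>\<omega>\<in>space \<Omega> - B. \<bar>deviation P n (\<lambda>i. X i \<omega>) (\<lambda>x. ln (g0 x))\<bar> \<le> C1 * ?r n)"
        by (elim exE conjE)
      from deviation_root_n[OF \<open>prob_space \<Omega>\<close> \<open>iid_sample \<Omega> Q Y\<close> g0bd \<epsilon>]
      obtain C2 where C2: "0 \<le> C2" and dQ: "\<forall>n\<ge>1. \<exists>B\<in>sets \<Omega>. measure \<Omega> B \<le> \<epsilon> / 4 \<and>
         (\<forall>\<omega>\<in>space \<Omega> - B. \<bar>deviation Q n (\<lambda>i. Y i \<omega>) g0\<bar> \<le> C2 * ?r n)"
        by (elim exE conjE)
      \<comment> \<open>\<open>K\<close> bounds the gain from above, since its rate is at least as
        fast as \<open>n powr (- 1 / 2)\<close>; \<open>K * L\<close> bounds it from below through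
        the upper bound on \<open>lam\<close>; \<open>C1\<close> and \<open>C2\<close> come from the
        means of \<open>ln g0\<close> and \<open>g0\<close>.\<close>
      define C where "C = K + K * L + C1 + C2"
      have C: "0 < C" using K L C1 C2 by (simp add: C_def add_pos_nonneg)
      have "\<forall>\<^sub>F n in sequentially. \<exists>A\<in>sets \<Omega>. {\<omega> \<in> space \<Omega>. \<bar>kl_estimate n (\<lambda>i. X i \<omega>) (\<lambda>i. Y i \<omega>) (g_hat n \<omega>)
          - KL_divergence (exp 1) Q P\<bar> > C * ?r n} \<subseteq> A \<and> measure \<Omega> A \<le> \<epsilon>"
        using ev evl eventually_ge_at_top[of 1]
      proof eventually_elim
        case (elim n)
        from elim(1) obtain B0 where B0: "B0 \<in> sets \<Omega>" "measure \<Omega> B0 \<le> \<epsilon> / 4"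
          and d0: "\<forall>\<omega>\<in>space \<Omega> - B0. log_ratio_gain n (\<lambda>i. X i \<omega>) (\<lambda>i. Y i \<omega>) g0 (g_hat n \<omega>) \<le> K * real n powr (- 2 / (2 + \<gamma>)) \<and>
            - (K * lam n \<omega>) \<le> log_ratio_gain n (\<lambda>i. X i \<omega>) (\<lambda>i. Y i \<omega>) g0 (g_hat n \<omega>)"
          by blast
        from elim(2) obtain B1 where B1: "B1 \<in> sets \<Omega>" "measure \<Omega> B1 \<le> \<epsilon> / 4"
          and d1: "{\<omega> \<in> space \<Omega>. \<bar>lam n \<omega>\<bar> > L * ?r n} \<subseteq> B1" by (elim bexE conjE)
        from dP[rule_format, OF elim(3)] obtain B2 where B2: "B2 \<in> sets \<Omega>" "measure \<Omega> B2 \<le> \<epsilon> / 4"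
          and d2: "\<forall>\<omega>\<in>space \<Omega> - B2. \<bar>deviation P n (\<lambda>i. X i \<omega>) (\<lambda>x. ln (g0 x))\<bar> \<le> C1 * ?r n"
          by (elim bexE conjE)
        from dQ[rule_format, OF elim(3)] obtain B3 where B3: "B3 \<in> sets \<Omega>" "measure \<Omega> B3 \<le> \<epsilon> / 4"
          and d3: "\<forall>\<omega>\<in>space \<Omega> - B3. \<bar>deviation Q n (\<lambda>i. Y i \<omega>) g0\<bar> \<le> C2 * ?r n"
          by (elim bexE conjE)
        define B where "B = B0 \<union> (B1 \<union> (B2 \<union> B3))"
        have Bm: "B \<in> sets \<Omega>" unfolding B_def using B0 B1 B2 B3 by blast
        have "measure \<Omega> B \<le> measure \<Omega> B0 + (measure \<Omega> B1 + (measure \<Omega> B2 + measure \<Omega> B3))"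
          unfolding B_def using B0(1) B1(1) B2(1) B3(1)
          by (intro order_trans[OF measure_Un_le] add_left_mono) auto
        also have "\<dots> \<le> \<epsilon>" using B0(2) B1(2) B2(2) B3(2) by linarith
        finally have MB: "measure \<Omega> B \<le> \<epsilon>" .
        have "\<bar>kl_estimate n (\<lambda>i. X i \<omega>) (\<lambda>i. Y i \<omega>) (g_hat n \<omega>) - KL_divergence (exp 1) Q P\<bar> \<le> C * ?r n"
          if \<omega>: "\<omega> \<in> space \<Omega> - B" for \<omega>
        proof -
          let ?gain = "log_ratio_gain n (\<lambda>i. X i \<omega>) (\<lambda>i. Y i \<omega>) g0 (g_hat n \<omega>)"
          have w: "\<omega> \<in> space \<Omega> - B0" "\<omega> \<in> space \<Omega>" "\<omega> \<notin> B1" "\<omega> \<in> space \<Omega> - B2" "\<omega> \<in> space \<Omega> - B3"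
            using \<omega> unfolding B_def by auto
          have "?gain \<le> K * real n powr (- 2 / (2 + \<gamma>))" using d0 w(1) by blast
          also have "\<dots> \<le> K * ?r n" using K powr_rate_le[OF iv(1,2) elim(3)] by (intro mult_left_mono) auto
          finally have 1: "?gain \<le> K * ?r n" .
          have "lam n \<omega> \<le> L * ?r n" using d1 w(2,3) by (auto simp: not_less)
          then have "K * lam n \<omega> \<le> K * (L * ?r n)" using K by (intro mult_left_mono) auto
          moreover have "- (K * lam n \<omega>) \<le> ?gain" using d0 w(1) by blast
          ultimately have 2: "- (K * (L * ?r n)) \<le> ?gain" by linarith
          have 3: "\<bar>deviation P n (\<lambda>i. X i \<omega>) (\<lambda>x. ln (g0 x))\<bar> \<le> C1 * ?r n" using d2 w(4) by blast
          have 4: "\<bar>deviation Q n (\<lambda>i. Y i \<omega>) g0\<bar> \<le> C2 * ?r n" using d3 w(5) by blast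
          have 5: "0 \<le> K * ?r n" "0 \<le> K * (L * ?r n)" using K L by simp_all
          have 6: "C * ?r n = K * ?r n + K * (L * ?r n) + C1 * ?r n + C2 * ?r n"
            unfolding C_def by (simp only: distrib_right mult.assoc)
          show ?thesis unfolding err 6 using 1 2 3 4 5 by linarith
        qed
        then have "{\<omega> \<in> space \<Omega>. \<bar>kl_estimate n (\<lambda>i. X i \<omega>) (\<lambda>i. Y i \<omega>) (g_hat n \<omega>)
          - KL_divergence (exp 1) Q P\<bar> > C * ?r n} \<subseteq> B" by (force simp: not_le[symmetric])
        then show ?case using Bm MB by blast
      qed
      then show "\<exists>C>0. \<forall>\<^sub>F n in sequentially. \<exists>A\<in>sets \<Omega>. {\<omega> \<in> space \<Omega>.
          \<bar>kl_estimate n (\<lambda>i. X i \<omega>) (\<lambda>i. Y i \<omega>) (g_hat n \<omega>) - KL_divergence (exp 1) Q P\<bar> > C * ?r n} \<subseteq> A \<and>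
          measure \<Omega> A \<le> \<epsilon>"
        using C by blast
    qed
  qed
  ultimately show ?thesis by blast
qed

end
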